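(* Let $n\ge 2$, let $a<b$ be real numbers, and let $W\in C^{1,1}_{loc}(\mathbb{R})$ be a potential such that $W'(a)=W'(b)=0$ and $W'<0$ on $(a,b)$. When $n\ge 3$, consider the condition $$(\ast)\qquad W'(s)\le -C_0(s-a)^{\frac{n}{n-2}}\ \text{ for all } s\in[a,s_0],\ \text{ for some } C_0>0 \text{ and some } s_0\in(a,b).$$ (i) Assume $u\in C^2(\mathbb{R}^n)$ is a solution of $\Delta u=W'(u)$ in $\mathbb{R}^n$ such that $u(\mathbb{R}^n)\subset[a,b]$. If $n=2$, or if $n\ge 3$ and $(\ast)$ holds, then either $u\equiv a$ or $u\equiv b$. Otherwise (when $n\ge 3$ and $(\ast)$ does not hold), either $u\equiv a$, or $u\equiv b$, or $$u(\mathbb{R}^n)\subset(a,C_W]\quad\text{and}\quad \liminf_{|x|\to\infty}u(x)=a,$$ where $C_W\in(a,b)$ is a constant depending only on $W$ (in particular not on $u$). (ii) Let $D\subset\mathbb{R}^n$ be a connected open unbounded set such that for every $R>0$, $D$ contains a ball of radius $R$. Assume $u\in C^2(D)$ is a solution of $\Delta u=W'(u)$ in $D$ such that $u(D)\subset(a,b]$. If there exist $C_0>0$ and $s_0\in(a,b)$ such that $W'(s)\le -C_0(s-a)$ for all $s\in[a,s_0]$, then $$\lim_{d(x,\partial D)\to\infty}u(x)=b.$$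
   Context: $d(x,\partial D)$ is the Euclidean distance from $x\in D$ to $\partial D$ (equal to $+\infty$ if $D=\mathbb{R}^n$). The statement $\lim_{d(x,\partial D)\to\infty}u(x)=b$ means: for every $\epsilon>0$ there is $M>0$ such that $|u(x)-b|<\epsilon$ for all $x\in D$ with $d(x,\partial D)>M$. The dimension $n$ is fixed throughout. *)

theory Defs
  imports "HOL-Analysis.Analysis"
begin

definition partial :: "'n \<Rightarrow> (real^'n \<Rightarrow> real) \<Rightarrow> real^'n \<Rightarrow> real"
  where "partial i u x = deriv (\<lambda>t. u (x + t *\<^sub>R axis i 1)) 0"

text \<open>The predicates \<open>C1_on\<close> and \<open>C2_on\<close> are meant for open sets \<open>D\<close>: there the partial
  derivatives at points of \<open>D\<close> do not depend on the values of \<open>u\<close> outside \<open>D\<close>.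
  The differentiability clause is needed because \<^const>\<open>deriv\<close> is total.\<close>

definition C1_on :: "(real^'n) set \<Rightarrow> (real^'n \<Rightarrow> real) \<Rightarrow> bool"
  where "C1_on D u \<longleftrightarrow>
    continuous_on D u \<and>
    (\<forall>i. (\<forall>x\<in>D. (\<lambda>t. u (x + t *\<^sub>R axis i 1)) field_differentiable (at 0)) \<and>
         continuous_on D (partial i u))"

definition C2_on :: "(real^'n) set \<Rightarrow> (real^'n \<Rightarrow> real) \<Rightarrow> bool"
  where "C2_on D u \<longleftrightarrow> C1_on D u \<and> (\<forall>i. C1_on D (partial i u))"

definition laplacian :: "(real^'n \<Rightarrow> real) \<Rightarrow> real^'n \<Rightarrow> real"
  where "laplacian u x = (\<Sum>i\<in>UNIV. partial i (partial i u) x)"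

definition C11_loc :: "(real \<Rightarrow> real) \<Rightarrow> bool"
  where "C11_loc W \<longleftrightarrow>
    (\<forall>s. W field_differentiable (at s)) \<and>
    (\<forall>K. compact K \<longrightarrow> (\<exists>L. L-lipschitz_on K (deriv W)))"

definition power_bound_near :: "(real \<Rightarrow> real) \<Rightarrow> real \<Rightarrow> real \<Rightarrow> real \<Rightarrow> bool"
  where "power_bound_near W a b p \<longleftrightarrow>
    (\<exists>C0>0. \<exists>s0\<in>{a<..<b}. \<forall>s\<in>{a..s0}. deriv W s \<le> - C0 * (s - a) powr p)"

text \<open>An infimum in \<^typ>\<open>ereal\<close> rather than \<^const>\<open>infdist\<close>: the value must be
  \<open>\<infinity>\<close> when the boundary is empty, whereas \<^const>\<open>infdist\<close> to the empty set is \<open>0\<close>.\<close>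

definition boundary_dist :: "(real^'n) set \<Rightarrow> real^'n \<Rightarrow> ereal"
  where "boundary_dist D x = (INF y\<in>frontier D. ereal (dist x y))"

definition tends_to_far_from_boundary ::
    "(real^'n) set \<Rightarrow> (real^'n \<Rightarrow> real) \<Rightarrow> real \<Rightarrow> bool"
  where "tends_to_far_from_boundary D u l \<longleftrightarrow>
    (\<forall>\<epsilon>>0. \<exists>M>0. \<forall>x\<in>D. boundary_dist D x > ereal M \<longrightarrow> \<bar>u x - l\<bar> < \<epsilon>)"

end

(* The whole theorem is a matter of comparison principles for f = -W' >= 0. A solution u is superharmonic, and
   each estimate compares it with an explicit radial subsolution that cannot touch u from below.
   If u >= s > a on a large ball, a paraboloid shows that u is close to b at the centre; so an entire
   solution bounded away from a is b. To bound u away from a, a bump a + k (1 - |y - c|^2/Q)^3 lying below u is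
   moved continuously: its height is raised in (ii), it is slid over the space to obtain C_W, and it is
   rescaled under condition ( * ). In the plane the logarithm alone is a sufficient barrier.
   For C_W one also needs that if u is close to b at a point then it stays above (a + b)/2 on a large ball;
   this follows from a Lipschitz estimate and a quantitative strong maximum principle for b - u. *)

theory Submission
  imports Defs
begin

section \<open>Coordinatewise Laplacians and comparison\<close>

text \<open>Since f need not be monotone, ordered boundary values do not by themselves order a
  solution and a subsolution. Two devices replace monotonicity. A fixed barrier h must satisfy its
  strict inequality only where u < h, which can confine u to a range where f is bounded below. A
  bump is moved through a continuous family from one that lies below u: at a first contact the two
  values agree, so f is needed only at the height of the bump. The cube in the bump has two
  purposes: being odd, it drops below a off its ball without any cutoff, and it makes the Laplacian
  nonnegative near the edge, where f may be arbitrarily small. So f needs a quantitative bound only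
  at heights between \<theta> k and k above a, with \<theta> = (4/(n+4))^3, and the condition is
  6nk/Q < f there. A linear bound on f gives it for one Q and all small k. The exponent n/(n-2)
  gives it along k = const Q^(-(n-2)/2), when both sides scale like Q^(-n/2). With no bound on f
  near a, the height stays fixed and the bump is only translated, from a place where u is already
  high; this is why C_W appears.\<close>

definition has_second_deriv0 :: "(real \<Rightarrow> real) \<Rightarrow> real \<Rightarrow> bool" where
  "has_second_deriv0 \<phi> d \<longleftrightarrow>
    (\<exists>g. (\<forall>\<^sub>F t in nhds 0. (\<phi> has_real_derivative g t) (at t)) \<and> (g has_real_derivative d) (at 0))"

text \<open>A relation rather than a value, because \<open>deriv\<close> is total: it also asserts
  that the second derivatives exist. Only the coordinate lines through \<open>x\<close> are
  inspected, so radial functions, translations and reflections reduce to calculus in one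
  variable.\<close>

definition has_lap :: "(real^'n \<Rightarrow> real) \<Rightarrow> real^'n \<Rightarrow> real \<Rightarrow> bool" where
  "has_lap v x l \<longleftrightarrow>
    (\<exists>d. (\<forall>i. has_second_deriv0 (\<lambda>t. v (x + t *\<^sub>R axis i 1)) (d i)) \<and> l = (\<Sum>i\<in>UNIV. d i))"

lemma has_second_deriv0_diff:
  assumes "has_second_deriv0 \<phi> d" "has_second_deriv0 \<psi> e"
  shows "has_second_deriv0 (\<lambda>t. \<phi> t - \<psi> t) (d - e)"
proof -
  obtain g where g: "\<forall>\<^sub>F t in nhds 0. (\<phi> has_real_derivative g t) (at t)" "(g has_real_derivative d) (at 0)"
    using assms(1) unfolding has_second_deriv0_def by blast
  obtain h where h: "\<forall>\<^sub>F t in nhds 0. (\<psi> has_real_derivative h t) (at t)" "(h has_real_derivative e) (at 0)"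
    using assms(2) unfolding has_second_deriv0_def by blast
  have "\<forall>\<^sub>F t in nhds 0. ((\<lambda>t. \<phi> t - \<psi> t) has_real_derivative g t - h t) (at t)"
    using g(1) h(1) by eventually_elim (auto intro: DERIV_diff)
  moreover have "((\<lambda>t. g t - h t) has_real_derivative d - e) (at 0)"
    using g(2) h(2) by (rule DERIV_diff)
  ultimately show ?thesis
    unfolding has_second_deriv0_def by (intro exI[of _ "\<lambda>t. g t - h t"]) simp
qed

lemma has_second_deriv0_reflect:
  assumes "has_second_deriv0 \<phi> d"
  shows "has_second_deriv0 (\<lambda>t. \<phi> (- t)) d"
proof -
  obtain g where g: "\<forall>\<^sub>F t in nhds 0. (\<phi> has_real_derivative g t) (at t)" "(g has_real_derivative d) (at 0)"
    using assms unfolding has_second_deriv0_def by blast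
  have "filterlim (\<lambda>t::real. - t) (nhds 0) (nhds 0)"
    using tendsto_minus[OF filterlim_ident, of "0::real"] by simp
  then have "\<forall>\<^sub>F t in nhds 0. (\<phi> has_real_derivative g (- t)) (at (- t))"
    using g(1) unfolding filterlim_iff by blast
  then have "\<forall>\<^sub>F t in nhds 0. ((\<lambda>t. \<phi> (- t)) has_real_derivative - g (- t)) (at t)"
    by eventually_elim (use DERIV_mirror in blast)
  moreover have "((\<lambda>t. - g (- t)) has_real_derivative d) (at 0)"
    using DERIV_minus[OF DERIV_mirror[THEN iffD1, of g d 0]] g(2) by simp
  ultimately show ?thesis
    unfolding has_second_deriv0_def by (intro exI[of _ "\<lambda>t. - g (- t)"]) simp
qed

lemma has_second_deriv0_quadratic: "has_second_deriv0 (\<lambda>t. A + B * t + C * t\<^sup>2) (2 * C)"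
  unfolding has_second_deriv0_def
  by (rule exI[of _ "\<lambda>t. B + 2 * C * t"]) (auto intro!: derivative_eq_intros always_eventually)

text \<open>If \<open>d < 0\<close>, then \<open>g\<close>, which vanishes at 0 by the first
  derivative test, is negative just to the right of 0, and the mean value theorem makes \<phi> drop
  below its minimum.\<close>

lemma has_second_deriv0_min:
  assumes "has_second_deriv0 \<phi> d" and min: "\<forall>\<^sub>F t in nhds 0. \<phi> 0 \<le> \<phi> t"
  shows "0 \<le> d"
proof (rule ccontr)
  assume "\<not> 0 \<le> d"
  obtain g where g: "\<forall>\<^sub>F t in nhds 0. (\<phi> has_real_derivative g t) (at t)" "(g has_real_derivative d) (at 0)"
    using assms unfolding has_second_deriv0_def by blast
  obtain e where e: "e > 0" "\<And>t. \<bar>t\<bar> < e \<Longrightarrow> (\<phi> has_real_derivative g t) (at t) \<and> \<phi> 0 \<le> \<phi> t"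
    using eventually_conj[OF g(1) min] unfolding eventually_nhds_metric by (auto simp: dist_real_def)
  have g0: "g 0 = 0"
    using DERIV_local_min[of \<phi> "g 0" 0 e] e by simp
  obtain e' where e': "e' > 0" "\<And>h. h > 0 \<Longrightarrow> h < e' \<Longrightarrow> g (0 + h) < g 0"
    using DERIV_neg_dec_right[OF g(2)] \<open>\<not> 0 \<le> d\<close> by force
  define h where "h = min e e' / 2"
  have h: "0 < h" "h < e" "h < e'"
    using e(1) e'(1) by (auto simp: h_def min_def)
  obtain z where z: "0 < z" "z < h" "\<phi> h - \<phi> 0 = (h - 0) * g z"
    using MVT2[of 0 h \<phi> g] h e(2) by auto
  have "g z < 0" using e'(2)[of z] z h g0 by simp
  then have "\<phi> h < \<phi> 0" using z(3) h(1) mult_pos_neg[of h "g z"] by simp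
  with e(2)[of h] h show False by simp
qed

lemma has_lap_diff:
  assumes "has_lap v x l" "has_lap w x m"
  shows "has_lap (\<lambda>y. v y - w y) x (l - m)"
proof -
  obtain d where d: "\<And>i. has_second_deriv0 (\<lambda>t. v (x + t *\<^sub>R axis i 1)) (d i)" "l = sum d UNIV"
    using assms(1) unfolding has_lap_def by auto
  obtain e where e: "\<And>i. has_second_deriv0 (\<lambda>t. w (x + t *\<^sub>R axis i 1)) (e i)" "m = sum e UNIV"
    using assms(2) unfolding has_lap_def by auto
  show ?thesis
    unfolding has_lap_def
    by (rule exI[of _ "\<lambda>i. d i - e i"])
       (auto intro!: has_second_deriv0_diff d(1) e(1) simp: d(2) e(2) sum_subtractf)
qed

lemma has_lap_const: "has_lap (\<lambda>y. c) x 0"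
  unfolding has_lap_def
  using has_second_deriv0_quadratic[of c 0 0] by (intro exI[of _ "\<lambda>i. 0"]) auto

lemma has_lap_min:
  assumes "has_lap v x l" and "\<forall>\<^sub>F y in nhds x. v x \<le> v y"
  shows "0 \<le> l"
proof -
  obtain d where d: "\<And>i. has_second_deriv0 (\<lambda>t. v (x + t *\<^sub>R axis i 1)) (d i)" "l = sum d UNIV"
    using assms(1) unfolding has_lap_def by auto
  have "0 \<le> d i" for i
  proof (rule has_second_deriv0_min[OF d(1)])
    have "((\<lambda>t. x + t *\<^sub>R axis i (1::real)) \<longlongrightarrow> x + 0 *\<^sub>R axis i 1) (nhds 0)"
      by (intro tendsto_intros filterlim_ident)
    then show "\<forall>\<^sub>F t in nhds 0. v (x + 0 *\<^sub>R axis i 1) \<le> v (x + t *\<^sub>R axis i 1)"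
      using eventually_compose_filterlim[OF assms(2)] by simp
  qed
  then show ?thesis unfolding d(2) by (intro sum_nonneg) auto
qed

lemma C2_on_has_lap:
  assumes "open D" "C2_on D u" "x \<in> D"
  shows "has_lap u x (laplacian u x)"
  unfolding has_lap_def laplacian_def
proof (intro exI[of _ "\<lambda>i. partial i (partial i u) x"] conjI allI refl)
  fix i
  have D: "\<forall>y\<in>D. (\<lambda>t. v (y + t *\<^sub>R axis i 1)) field_differentiable (at 0)" if "C1_on D v" for v
    using that unfolding C1_on_def by blast
  \<comment> \<open>\<open>partial\<close> is a derivative at 0 along the line through the given
    point; shifting the parameter turns it into a derivative at \<open>t\<close> along the one line
    through \<open>x\<close>.\<close>
  have deriv: "((\<lambda>s. v (x + s *\<^sub>R axis i 1)) has_real_derivative partial i v (x + t *\<^sub>R axis i 1)) (at t)"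
    if "C1_on D v" "x + t *\<^sub>R axis i 1 \<in> D" for v t
  proof -
    have "((\<lambda>s. v (x + t *\<^sub>R axis i 1 + s *\<^sub>R axis i 1)) has_real_derivative partial i v (x + t *\<^sub>R axis i 1)) (at 0)"
      using D[OF that(1)] that(2) unfolding partial_def
      by (intro field_differentiable_derivI) auto
    then have "((\<lambda>s. v (x + (s + t) *\<^sub>R axis i 1)) has_real_derivative partial i v (x + t *\<^sub>R axis i 1)) (at 0)"
      by (simp add: algebra_simps)
    then show ?thesis
      using DERIV_shift[of "\<lambda>s. v (x + s *\<^sub>R axis i 1)" _ 0 t] by simp
  qed
  have "((\<lambda>t. x + t *\<^sub>R axis i (1::real)) \<longlongrightarrow> x + 0 *\<^sub>R axis i 1) (nhds 0)"
    by (intro tendsto_intros filterlim_ident)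
  then have ev: "\<forall>\<^sub>F t in nhds 0. x + t *\<^sub>R axis i 1 \<in> D"
    using assms(1,3) by (auto simp: tendsto_def)
  have C1: "C1_on D u" "C1_on D (partial i u)"
    using assms(2) unfolding C2_on_def by auto
  show "has_second_deriv0 (\<lambda>t. u (x + t *\<^sub>R axis i 1)) (partial i (partial i u) x)"
    unfolding has_second_deriv0_def
  proof (intro exI[of _ "\<lambda>t. partial i u (x + t *\<^sub>R axis i 1)"] conjI)
    show "\<forall>\<^sub>F t in nhds 0. ((\<lambda>s. u (x + s *\<^sub>R axis i 1)) has_real_derivative partial i u (x + t *\<^sub>R axis i 1)) (at t)"
      using ev by eventually_elim (rule deriv[OF C1(1)])
    show "((\<lambda>t. partial i u (x + t *\<^sub>R axis i 1)) has_real_derivative partial i (partial i u) x) (at 0)"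
      using deriv[OF C1(2), of 0] assms(3) by simp
  qed
qed

lemma norm_add_axis_sq:
  fixes z :: "real^'n"
  shows "(norm (z + t *\<^sub>R axis i 1))\<^sup>2 = (norm z)\<^sup>2 + 2 * z $ i * t + t\<^sup>2"
  unfolding power2_norm_eq_inner
  by (simp only: inner_add_left inner_add_right inner_scaleR_left inner_scaleR_right inner_axis inner_axis' inner_axis_axis)
     (simp add: power2_eq_square algebra_simps)

text \<open>Along each axis the squared distance to \<open>p\<close> is a quadratic polynomial in
  \<open>t\<close>, so the chain rule suffices. Using the square as radial variable avoids the
  singularity of the norm at the centre.\<close>

lemma has_lap_radial:
  fixes x p :: "real^'n"
  defines "q \<equiv> (norm (x - p))\<^sup>2"
  assumes h: "\<forall>\<^sub>F s in nhds q. (h has_real_derivative h' s) (at s)"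
    and h': "(h' has_real_derivative h'') (at q)"
  shows "has_lap (\<lambda>y. h ((norm (y - p))\<^sup>2)) x (2 * real CARD('n) * h' q + 4 * q * h'')"
  unfolding has_lap_def
proof (intro exI[of _ "\<lambda>i. 2 * h' q + 4 * ((x - p) $ i)\<^sup>2 * h''"] conjI allI)
  fix i
  define m where "m = (x - p) $ i"
  have eq: "(norm (x + t *\<^sub>R axis i 1 - p))\<^sup>2 = q + 2 * m * t + t\<^sup>2" for t
    using norm_add_axis_sq[of "x - p" t i] by (simp add: q_def m_def algebra_simps)
  have "((\<lambda>t. q + 2 * m * t + t\<^sup>2) \<longlongrightarrow> q + 2 * m * 0 + 0\<^sup>2) (nhds 0)"
    by (intro tendsto_intros filterlim_ident)
  then have "\<forall>\<^sub>F t in nhds 0. (h has_real_derivative h' (q + 2 * m * t + t\<^sup>2)) (at (q + 2 * m * t + t\<^sup>2))"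
    using eventually_compose_filterlim[OF h] by simp
  then have 1: "\<forall>\<^sub>F t in nhds 0. ((\<lambda>t. h (q + 2 * m * t + t\<^sup>2)) has_real_derivative
      h' (q + 2 * m * t + t\<^sup>2) * (2 * m + 2 * t)) (at t)"
    by eventually_elim (rule DERIV_chain2, assumption, auto intro!: derivative_eq_intros)
  have "((\<lambda>t. h' (q + 2 * m * t + t\<^sup>2)) has_real_derivative h'' * (2 * m)) (at 0)"
    by (rule DERIV_chain2[where g = "\<lambda>t. q + 2 * m * t + t\<^sup>2"])
       (use h' in \<open>auto intro!: derivative_eq_intros\<close>)
  then have 2: "((\<lambda>t. h' (q + 2 * m * t + t\<^sup>2) * (2 * m + 2 * t)) has_real_derivative
      2 * h' q + 4 * m\<^sup>2 * h'') (at 0)"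
    by (auto intro!: derivative_eq_intros simp: power2_eq_square)
  show "has_second_deriv0 (\<lambda>t. h ((norm (x + t *\<^sub>R axis i 1 - p))\<^sup>2)) (2 * h' q + 4 * ((x - p) $ i)\<^sup>2 * h'')"
    unfolding eq has_second_deriv0_def m_def[symmetric] by (intro exI conjI) (rule 1, rule 2)
next
  have "q = (\<Sum>i\<in>UNIV. ((x - p) $ i)\<^sup>2)"
    unfolding q_def by (simp add: norm_vec_def L2_set_def sum_nonneg)
  then show "2 * real CARD('n) * h' q + 4 * q * h'' = (\<Sum>i\<in>UNIV. 2 * h' q + 4 * ((x - p) $ i)\<^sup>2 * h'')"
    by (simp add: sum.distrib sum_distrib_left sum_distrib_right mult_ac)
qed

text \<open>A negative minimum over \<open>K\<close> would lie in \<open>U\<close> and contradict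
  the second derivative test. Hence the Laplacian has to be controlled only at points where
  \<open>g\<close> is negative.\<close>

lemma comparison_nonneg:
  fixes g :: "real^'n \<Rightarrow> real"
  assumes "compact K" "open U" "U \<subseteq> K" "continuous_on K g"
    and bd: "\<And>y. y \<in> K - U \<Longrightarrow> 0 \<le> g y"
    and lap: "\<And>y. y \<in> U \<Longrightarrow> g y < 0 \<Longrightarrow> \<exists>l<0. has_lap g y l"
    and "x \<in> K"
  shows "0 \<le> g x"
proof (rule ccontr)
  assume neg: "\<not> 0 \<le> g x"
  obtain y where y: "y \<in> K" "\<And>z. z \<in> K \<Longrightarrow> g y \<le> g z"
    using continuous_attains_inf[OF \<open>compact K\<close> _ \<open>continuous_on K g\<close>] \<open>x \<in> K\<close> by blast
  have "g y < 0" using y(2)[OF \<open>x \<in> K\<close>] neg by simp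
  then have "y \<in> U" using bd[of y] y(1) by force
  then obtain l where l: "l < 0" "has_lap g y l" using lap \<open>g y < 0\<close> by blast
  have "\<forall>\<^sub>F z in nhds y. g y \<le> g z"
    using eventually_nhds_in_open[OF \<open>open U\<close> \<open>y \<in> U\<close>] y(2) \<open>U \<subseteq> K\<close>
    by (auto elim!: eventually_mono)
  then show False using has_lap_min[OF l(2)] l(1) by simp
qed

text \<open>The form in which barriers are used: \<open>sub\<close> may assume
  \<open>v y < h q\<close>, and this upper bound on \<open>v\<close> is what allows lower bounds for
  the nonlinearity to be applied.\<close>

lemma radial_comparison:
  fixes v :: "real^'n \<Rightarrow> real" and p :: "real^'n"
  assumes K: "compact K" "open U" "U \<subseteq> K" "continuous_on K v"
    and cont: "continuous_on ((\<lambda>y. (norm (y - p))\<^sup>2) ` K) h"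
    and lap: "\<And>y. y \<in> U \<Longrightarrow> has_lap v y (l y)"
    and h: "\<And>y. y \<in> U \<Longrightarrow> \<forall>\<^sub>F s in nhds ((norm (y - p))\<^sup>2). (h has_real_derivative h' s) (at s)"
    and h': "\<And>y. y \<in> U \<Longrightarrow> (h' has_real_derivative h'' ((norm (y - p))\<^sup>2)) (at ((norm (y - p))\<^sup>2))"
    and bd: "\<And>y. y \<in> K - U \<Longrightarrow> h ((norm (y - p))\<^sup>2) \<le> v y"
    and sub: "\<And>y q. y \<in> U \<Longrightarrow> q = (norm (y - p))\<^sup>2 \<Longrightarrow> v y < h q \<Longrightarrow>
                l y < 2 * real CARD('n) * h' q + 4 * q * h'' q"
    and "x \<in> K"
  shows "h ((norm (x - p))\<^sup>2) \<le> v x"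
proof -
  have "0 \<le> v x - h ((norm (x - p))\<^sup>2)"
  proof (rule comparison_nonneg[OF K(1-3) _ _ _ \<open>x \<in> K\<close>])
    show "continuous_on K (\<lambda>y. v y - h ((norm (y - p))\<^sup>2))"
      by (intro continuous_intros K(4) continuous_on_compose2[OF cont]) auto
    show "0 \<le> v y - h ((norm (y - p))\<^sup>2)" if "y \<in> K - U" for y
      using bd[OF that] by simp
    show "\<exists>l<0. has_lap (\<lambda>y. v y - h ((norm (y - p))\<^sup>2)) y l"
      if "y \<in> U" "v y - h ((norm (y - p))\<^sup>2) < 0" for y
      using has_lap_diff[OF lap[OF that(1)] has_lap_radial[OF h[OF that(1)] h'[OF that(1)]]]
        sub[OF that(1) refl] that(2) by (intro exI conjI) auto
  qed
  then show ?thesis by simp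
qed

section \<open>Maximum principles\<close>

lemma square_norm_less_iff: "0 \<le> R \<Longrightarrow> (norm z)\<^sup>2 < R\<^sup>2 \<longleftrightarrow> norm z < R"
  using power_strict_mono[of "norm z" R 2] power_less_imp_less_base[of "norm z" 2 R] by auto

lemma powr_radial_derivs:
  fixes q :: real
  assumes "0 < q"
  shows "\<forall>\<^sub>F s in nhds q. ((\<lambda>s. c * (s powr - \<beta> - d)) has_real_derivative c * (- \<beta> * s powr (- \<beta> - 1))) (at s)"
    and "((\<lambda>s. c * (- \<beta> * s powr (- \<beta> - 1))) has_real_derivative c * (\<beta> * (\<beta> + 1) * q powr (- \<beta> - 2))) (at q)"
proof -
  have "\<forall>\<^sub>F s in nhds q. 0 < s"
    using eventually_nhds_in_open[of "{0<..}" q] assms by (auto elim!: eventually_mono)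
  then show "\<forall>\<^sub>F s in nhds q. ((\<lambda>s. c * (s powr - \<beta> - d)) has_real_derivative c * (- \<beta> * s powr (- \<beta> - 1))) (at s)"
    by eventually_elim (auto intro!: derivative_eq_intros)
  show "((\<lambda>s. c * (- \<beta> * s powr (- \<beta> - 1))) has_real_derivative c * (\<beta> * (\<beta> + 1) * q powr (- \<beta> - 2))) (at q)"
    using assms by (auto intro!: derivative_eq_intros simp: algebra_simps)
qed

lemma powr_radial_laplacian:
  fixes q :: real
  assumes "0 < q"
  shows "2 * N * (c * (- \<beta> * q powr (- \<beta> - 1))) + 4 * q * (c * (\<beta> * (\<beta> + 1) * q powr (- \<beta> - 2)))
    = c * \<beta> * (4 * \<beta> + 4 - 2 * N) * q powr (- \<beta> - 1)"
proof -
  have "1 + (- \<beta> - 2) = - \<beta> - 1" by simp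
  then have "q powr (- \<beta> - 1) = q * q powr (- \<beta> - 2)"
    using assms powr_add[of q 1 "- \<beta> - 2"] by (metis powr_one less_imp_le)
  then show ?thesis by (simp only:) (simp add: algebra_simps)
qed

text \<open>A quantitative strong minimum principle: the barrier is a multiple of
  \<open>|x - y|\<^sup>-\<^sup>2\<^sup>\<beta> - (2R)\<^sup>-\<^sup>2\<^sup>\<beta>\<close>, and a large \<open>\<beta>\<close> absorbs the zeroth order term.\<close>

lemma supersolution_lower_bound:
  fixes \<eta> \<rho> R L :: real
  assumes "0 < \<eta>" "0 < \<rho>" "\<rho> \<le> R" "0 \<le> L"
  obtains c where "0 < c"
    "\<And>(w :: real^'n \<Rightarrow> real) l y x. continuous_on UNIV w \<Longrightarrow> (\<And>z. has_lap w z (l z)) \<Longrightarrow>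
      (\<And>z. l z \<le> L * w z) \<Longrightarrow> (\<And>z. 0 \<le> w z) \<Longrightarrow> (\<And>z. dist z y \<le> \<rho> \<Longrightarrow> \<eta> \<le> w z) \<Longrightarrow>
      dist x y \<le> R \<Longrightarrow> c \<le> w x"
proof -
  define N where "N = real CARD('n)"
  \<comment> \<open>The barrier lives between the radii \<rho> and 2R; the doubling keeps it
    positive up to radius \<open>R\<close>. Since \<beta> is at least n and exceeds
    \<open>L * Q\<close>, its Laplacian exceeds \<open>L\<close> times the barrier. The factor
    \<open>A\<close> makes it at most \<eta> on the inner sphere. Nothing here depends on the
    function to be estimated.\<close>
  define Q where "Q = (2 * R)\<^sup>2"
  define \<beta> where "\<beta> = N + L * Q"
  define A where "A = \<eta> * (\<rho>\<^sup>2) powr \<beta>"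
  define c where "c = min \<eta> (A * ((R\<^sup>2) powr - \<beta> - Q powr - \<beta>))"
  have N: "1 \<le> N" unfolding N_def by (simp add: Suc_leI)
  have R: "0 < R" using assms by simp
  have Q: "0 < Q" "R\<^sup>2 < Q" using R by (auto simp: Q_def power2_eq_square)
  have \<beta>: "1 \<le> \<beta>" "L * Q < \<beta> * (4 * \<beta> + 4 - 2 * N)"
  proof -
    have LQ: "0 \<le> L * Q" using assms Q by simp
    show "1 \<le> \<beta>" using N LQ by (simp add: \<beta>_def)
    have "L * Q < \<beta>" using N by (simp add: \<beta>_def)
    also have "\<beta> * 1 \<le> \<beta> * (4 * \<beta> + 4 - 2 * N)"
      using N LQ by (intro mult_left_mono) (auto simp: \<beta>_def)
    finally show "L * Q < \<beta> * (4 * \<beta> + 4 - 2 * N)" by simp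
  qed
  have A: "0 < A" using assms by (simp add: A_def)
  have "Q powr - \<beta> < (R\<^sup>2) powr - \<beta>"
    using Q R \<beta>(1) by (intro powr_less_mono2_neg) auto
  then have "0 < c" using assms(1) A by (simp add: c_def)
  moreover have "c \<le> w x"
    if w: "continuous_on UNIV w" "\<And>z. has_lap w z (l z)" "\<And>z. l z \<le> L * w z" "\<And>z. 0 \<le> w z"
      "\<And>z. dist z y \<le> \<rho> \<Longrightarrow> \<eta> \<le> w z" and x: "dist x y \<le> R" for w :: "real^'n \<Rightarrow> real" and l y x
  proof (cases "dist x y \<le> \<rho>")
    case True
    then show ?thesis using w(5)[of x] by (simp add: c_def)
  next
    case False
    define K where "K = cball y (2 * R) - ball y \<rho>"
    define U where "U = ball y (2 * R) - cball y \<rho>"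
    define h where "h = (\<lambda>q. A * (q powr - \<beta> - Q powr - \<beta>))"
    have pos: "0 < (norm (z - y))\<^sup>2" if "z \<in> K" for z
      using that assms(2) by (auto simp: K_def dist_norm norm_minus_commute)
    have "h ((norm (x - y))\<^sup>2) \<le> w x"
    proof (rule radial_comparison[where K = K and U = U and l = l and
          h' = "\<lambda>s. A * (- \<beta> * s powr (- \<beta> - 1))" and h'' = "\<lambda>s. A * (\<beta> * (\<beta> + 1) * s powr (- \<beta> - 2))"])
      show "compact K" unfolding K_def by (intro compact_diff) auto
      show "open U" unfolding U_def by auto
      show UK: "U \<subseteq> K" by (auto simp: U_def K_def)
      show "continuous_on K w" using w(1) continuous_on_subset by blast
      show "continuous_on ((\<lambda>z. (norm (z - y))\<^sup>2) ` K) h"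
        unfolding h_def using pos by (intro continuous_intros) force+
      show "has_lap w z (l z)" for z by (rule w(2))
      show "x \<in> K" using x False R by (auto simp: K_def dist_commute)
      fix z
      show "h ((norm (z - y))\<^sup>2) \<le> w z" if "z \<in> K - U"
      proof -
        have "norm (z - y) = \<rho> \<or> norm (z - y) = 2 * R"
          using that by (simp add: K_def U_def dist_norm norm_minus_commute) linarith
        then show ?thesis
        proof
          assume 1: "norm (z - y) = \<rho>"
          have "h (\<rho>\<^sup>2) = \<eta> - A * Q powr - \<beta>"
            using assms by (simp add: h_def A_def algebra_simps powr_minus)
          also have "\<dots> \<le> \<eta>" using A by simp
          also have "\<dots> \<le> w z" using w(5)[of z] 1 by (simp add: dist_norm)
          finally show ?thesis using 1 by simp
        next
          assume 2: "norm (z - y) = 2 * R"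
          then show ?thesis using w(4)[of z] by (simp add: h_def Q_def)
        qed
      qed
      assume z: "z \<in> U"
      then have q: "0 < (norm (z - y))\<^sup>2" using pos UK by blast
      show "\<forall>\<^sub>F s in nhds ((norm (z - y))\<^sup>2). (h has_real_derivative A * (- \<beta> * s powr (- \<beta> - 1))) (at s)"
        unfolding h_def by (rule powr_radial_derivs(1)[OF q])
      show "((\<lambda>s. A * (- \<beta> * s powr (- \<beta> - 1))) has_real_derivative
          A * (\<beta> * (\<beta> + 1) * ((norm (z - y))\<^sup>2) powr (- \<beta> - 2))) (at ((norm (z - y))\<^sup>2))"
        by (rule powr_radial_derivs(2)[OF q])
      fix q assume q_def: "q = (norm (z - y))\<^sup>2" and less: "w z < h q"
      have q: "0 < q" using q q_def by simp
      have qQ: "q < Q" using z R unfolding q_def Q_def U_def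
        by (subst square_norm_less_iff) (auto simp: dist_norm norm_minus_commute)
      have "l z \<le> L * w z" by (rule w(3))
      also have "\<dots> \<le> L * h q" using less assms(4) by (intro mult_left_mono) auto
      also have "\<dots> \<le> L * (A * q powr - \<beta>)"
        using A assms(4) by (intro mult_left_mono) (auto simp: h_def)
      also have "\<dots> = A * q powr (- \<beta> - 1) * (L * q)"
        using q powr_add[of q 1 "- \<beta> - 1"] by (simp add: mult_ac)
      also have "\<dots> \<le> A * q powr (- \<beta> - 1) * (L * Q)"
        using A q qQ assms(4) by (intro mult_left_mono) auto
      also have "\<dots> < A * q powr (- \<beta> - 1) * (\<beta> * (4 * \<beta> + 4 - 2 * N))"
        using A q \<beta>(2) by (intro mult_strict_left_mono) auto
      also have "\<dots> = 2 * N * (A * (- \<beta> * q powr (- \<beta> - 1))) + 4 * q * (A * (\<beta> * (\<beta> + 1) * q powr (- \<beta> - 2)))"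
        unfolding powr_radial_laplacian[OF q] by (simp add: mult_ac)
      finally show "l z < 2 * real CARD('n) * (A * (- \<beta> * q powr (- \<beta> - 1))) + 4 * q * (A * (\<beta> * (\<beta> + 1) * q powr (- \<beta> - 2)))"
        by (simp add: N_def)
    qed
    moreover have "h (R\<^sup>2) \<le> h ((norm (x - y))\<^sup>2)"
    proof -
      have "0 < norm (x - y)" "norm (x - y) \<le> R"
        using False assms x by (auto simp: dist_norm)
      then have "(R\<^sup>2) powr - \<beta> \<le> ((norm (x - y))\<^sup>2) powr - \<beta>"
        using \<beta>(1) by (intro powr_mono2') (auto intro: power_mono)
      then show ?thesis using A by (simp add: h_def)
    qed
    ultimately show ?thesis by (simp add: c_def h_def)
  qed
  ultimately show ?thesis using that by blast
qed

section \<open>The equation: maximum principles at a and b, and closeness to b\<close>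

locale potential =
  fixes W :: "real \<Rightarrow> real" and a b :: real
  assumes ab: "a < b" and C11: "C11_loc W" and W'a: "deriv W a = 0" and W'b: "deriv W b = 0"
    and W'neg: "\<And>s. a < s \<Longrightarrow> s < b \<Longrightarrow> deriv W s < 0"
begin

definition f :: "real \<Rightarrow> real" where "f s = - deriv W s"

definition solution :: "(real^'n) set \<Rightarrow> (real^'n \<Rightarrow> real) \<Rightarrow> bool" where
  "solution D u \<longleftrightarrow> open D \<and> C2_on D u \<and> (\<forall>x\<in>D. laplacian u x = - f (u x)) \<and> u ` D \<subseteq> {a..b}"

lemma f_pos: "a < s \<Longrightarrow> s < b \<Longrightarrow> 0 < f s"
  using W'neg[of s] by (simp add: f_def)

lemma f_ends: "f a = 0" "f b = 0"
  by (simp_all add: f_def W'a W'b)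

lemma f_nonneg: "a \<le> s \<Longrightarrow> s \<le> b \<Longrightarrow> 0 \<le> f s"
  using f_pos[of s] f_ends by (cases "s = a \<or> s = b") auto

lemma f_lipschitz:
  obtains L where "0 \<le> L" "\<And>s t. s \<in> {a..b} \<Longrightarrow> t \<in> {a..b} \<Longrightarrow> \<bar>f s - f t\<bar> \<le> L * \<bar>s - t\<bar>"
proof -
  obtain L where L: "L-lipschitz_on {a..b} (deriv W)"
    using C11 unfolding C11_loc_def by (meson compact_Icc)
  show ?thesis
    using lipschitz_on_nonneg[OF L] lipschitz_onD[OF L]
    by (intro that[of L]) (auto simp: f_def dist_real_def abs_minus_commute)
qed

text \<open>By continuity \<open>f\<close> attains a positive minimum on a compact part of the open
  interval. An empty range is allowed, so that callers need not compare \<open>s\<close> with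
  \<open>t\<close>.\<close>

lemma f_lower_bound:
  assumes "a < s" "t < b"
  obtains c where "0 < c" "\<And>r. s \<le> r \<Longrightarrow> r \<le> t \<Longrightarrow> c \<le> f r"
proof (cases "s \<le> t")
  case True
  obtain L where L: "0 \<le> L" "\<And>s t. s \<in> {a..b} \<Longrightarrow> t \<in> {a..b} \<Longrightarrow> \<bar>f s - f t\<bar> \<le> L * \<bar>s - t\<bar>"
    using f_lipschitz by blast
  have "L-lipschitz_on {s..t} f"
    by (rule lipschitz_onI) (use L assms in \<open>auto simp: dist_real_def\<close>)
  then have "continuous_on {s..t} f" by (rule lipschitz_on_continuous_on)
  then obtain r where "r \<in> {s..t}" "\<And>r'. r' \<in> {s..t} \<Longrightarrow> f r \<le> f r'"
    using continuous_attains_inf[of "{s..t}" f] True by auto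
  then show ?thesis using that[of "f r"] f_pos[of r] assms by auto
next
  case False
  then show ?thesis using that[of 1] by auto
qed

lemma solution_has_lap: "solution D u \<Longrightarrow> x \<in> D \<Longrightarrow> has_lap u x (- f (u x))"
  using C2_on_has_lap[of D u x] unfolding solution_def by auto

lemma solution_continuous: "solution D u \<Longrightarrow> continuous_on D u"
  unfolding solution_def C2_on_def C1_on_def by auto

lemma solution_range: "solution D u \<Longrightarrow> x \<in> D \<Longrightarrow> a \<le> u x \<and> u x \<le> b"
  unfolding solution_def by force

text \<open>Since \<open>f\<close> is nonnegative, \<open>u - a\<close> is a nonnegative
  superharmonic function, and the quantitative minimum principle applies with
  \<open>L = 0\<close>.\<close>

lemma solution_eq_a:
  fixes u :: "real^'n \<Rightarrow> real"
  assumes u: "solution UNIV u" and "u x = a"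
  shows "u y = a"
proof (rule ccontr)
  assume "u y \<noteq> a"
  define \<eta> where "\<eta> = (u y - a) / 2"
  have \<eta>: "0 < \<eta>" using solution_range[OF u, of y] \<open>u y \<noteq> a\<close> by (simp add: \<eta>_def)
  have "isCont u y" using solution_continuous[OF u] by (simp add: continuous_on_eq_continuous_at)
  then obtain \<rho> where \<rho>: "0 < \<rho>" "\<And>z. dist z y < \<rho> \<Longrightarrow> dist (u z) (u y) < \<eta>"
    using \<eta> unfolding continuous_at_eps_delta by blast
  define R where "R = dist x y + \<rho>"
  obtain c where c: "0 < c" "\<And>(w :: real^'n \<Rightarrow> real) l y x. continuous_on UNIV w \<Longrightarrow> (\<And>z. has_lap w z (l z)) \<Longrightarrow>
      (\<And>z. l z \<le> 0 * w z) \<Longrightarrow> (\<And>z. 0 \<le> w z) \<Longrightarrow> (\<And>z. dist z y \<le> \<rho> / 2 \<Longrightarrow> \<eta> \<le> w z) \<Longrightarrow>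
      dist x y \<le> R \<Longrightarrow> c \<le> w x"
    by (rule supersolution_lower_bound[of \<eta> "\<rho> / 2" R 0]) (use \<eta> \<rho> in \<open>auto simp: R_def\<close>)
  have "c \<le> u x - a"
  proof (rule c(2)[of "\<lambda>z. u z - a" "\<lambda>z. - f (u z) - 0" y])
    show "continuous_on UNIV (\<lambda>z. u z - a)"
      using solution_continuous[OF u] by (intro continuous_intros)
    show "has_lap (\<lambda>z. u z - a) z (- f (u z) - 0)" for z
      by (intro has_lap_diff has_lap_const solution_has_lap[OF u]) simp
    show "- f (u z) - 0 \<le> 0 * (u z - a)" for z
      using f_nonneg[of "u z"] solution_range[OF u, of z] by simp
    show "\<eta> \<le> u z - a" if "dist z y \<le> \<rho> / 2" for z
      using \<rho>(2)[of z] \<rho>(1) that by (auto simp: dist_real_def \<eta>_def abs_if field_simps split: if_splits)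
  qed (use \<rho> solution_range[OF u] in \<open>auto simp: R_def\<close>)
  then show False using c(1) assms(2) by simp
qed

text \<open>The function \<open>b - u\<close> is subharmonic, so its sign of Laplacian is the wrong
  one; but f(u) = f(u) - f(b) is at most L (b - u) by the Lipschitz bound, and a linear zeroth order
  term is tolerated. The uniformity of \<open>c\<close> in \<open>u\<close> is what later makes C_W
  independent of \<open>u\<close>.\<close>

lemma quantitative_solution_eq_b:
  fixes \<eta> \<rho> R :: real
  assumes "0 < \<eta>" "0 < \<rho>" "\<rho> \<le> R"
  obtains c where "0 < c"
    "\<And>(u :: real^'n \<Rightarrow> real) y x. solution UNIV u \<Longrightarrow> (\<And>z. dist z y \<le> \<rho> \<Longrightarrow> u z \<le> b - \<eta>) \<Longrightarrow>
      dist x y \<le> R \<Longrightarrow> u x \<le> b - c"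
proof -
  obtain L where L: "0 \<le> L" "\<And>s t. s \<in> {a..b} \<Longrightarrow> t \<in> {a..b} \<Longrightarrow> \<bar>f s - f t\<bar> \<le> L * \<bar>s - t\<bar>"
    using f_lipschitz by blast
  obtain c where c: "0 < c" "\<And>(w :: real^'n \<Rightarrow> real) l y x. continuous_on UNIV w \<Longrightarrow> (\<And>z. has_lap w z (l z)) \<Longrightarrow>
      (\<And>z. l z \<le> L * w z) \<Longrightarrow> (\<And>z. 0 \<le> w z) \<Longrightarrow> (\<And>z. dist z y \<le> \<rho> \<Longrightarrow> \<eta> \<le> w z) \<Longrightarrow>
      dist x y \<le> R \<Longrightarrow> c \<le> w x"
    by (rule supersolution_lower_bound[OF assms L(1)]) auto
  have "u x \<le> b - c" if u: "solution UNIV u" and y: "\<And>z. dist z y \<le> \<rho> \<Longrightarrow> u z \<le> b - \<eta>"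
    and x: "dist x y \<le> R" for u :: "real^'n \<Rightarrow> real" and y x
  proof -
    have "c \<le> b - u x"
    proof (rule c(2)[of "\<lambda>z. b - u z" "\<lambda>z. 0 - - f (u z)" y])
      show "continuous_on UNIV (\<lambda>z. b - u z)"
        using solution_continuous[OF u] by (intro continuous_intros)
      show "has_lap (\<lambda>z. b - u z) z (0 - - f (u z))" for z
        by (intro has_lap_diff has_lap_const solution_has_lap[OF u]) simp
      show "0 - - f (u z) \<le> L * (b - u z)" for z
        using L(2)[of "u z" b] solution_range[OF u, of z] ab f_ends by auto
      show "0 \<le> b - u z" for z using solution_range[OF u, of z] by simp
      show "\<eta> \<le> b - u z" if "dist z y \<le> \<rho>" for z using y[OF that] by simp
    qed (rule x)
    then show ?thesis by simp
  qed
  then show ?thesis using that c(1) by blast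
qed

lemma solution_eq_b:
  fixes u :: "real^'n \<Rightarrow> real"
  assumes u: "solution UNIV u" and "u x = b"
  shows "u y = b"
proof (rule ccontr)
  assume "u y \<noteq> b"
  define \<eta> where "\<eta> = (b - u y) / 2"
  have \<eta>: "0 < \<eta>" using solution_range[OF u, of y] \<open>u y \<noteq> b\<close> by (simp add: \<eta>_def)
  have "isCont u y" using solution_continuous[OF u] by (simp add: continuous_on_eq_continuous_at)
  then obtain \<rho> where \<rho>: "0 < \<rho>" "\<And>z. dist z y < \<rho> \<Longrightarrow> dist (u z) (u y) < \<eta>"
    using \<eta> unfolding continuous_at_eps_delta by blast
  have near: "u z \<le> b - \<eta>" if "dist z y \<le> \<rho> / 2" for z
    using \<rho>(2)[of z] \<rho>(1) that by (auto simp: dist_real_def \<eta>_def abs_if field_simps split: if_splits)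
  obtain c where "0 < c" and c: "\<And>(u :: real^'n \<Rightarrow> real) y' x'. solution UNIV u \<Longrightarrow> (\<And>z. dist z y' \<le> \<rho> / 2 \<Longrightarrow> u z \<le> b - \<eta>) \<Longrightarrow>
      dist x' y' \<le> dist x y + \<rho> \<Longrightarrow> u x' \<le> b - c"
    by (rule quantitative_solution_eq_b[of \<eta> "\<rho> / 2" "dist x y + \<rho>"]) (use \<eta> \<rho> in auto)
  then have "u x \<le> b - c" using c[of u y x] u near \<rho>(1) by simp
  then show False using \<open>0 < c\<close> assms(2) by simp
qed

text \<open>Where \<open>u\<close> lies below a paraboloid with top \<open>b - \<epsilon>\<close>,
  it takes values between \<open>s\<close> and \<open>b - \<epsilon>\<close>, so f(u) is at least
  \<open>c\<close>, while the paraboloid has Laplacian -c/2.\<close>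

lemma solution_near_b:
  fixes s \<epsilon> :: real
  assumes "a < s" "0 < \<epsilon>"
  obtains R where "0 < R"
    "\<And>D (u :: real^'n \<Rightarrow> real) x. solution D u \<Longrightarrow> cball x R \<subseteq> D \<Longrightarrow> (\<And>y. y \<in> cball x R \<Longrightarrow> s \<le> u y) \<Longrightarrow>
       b - \<epsilon> \<le> u x"
proof -
  define N where "N = real CARD('n)"
  have N: "1 \<le> N" unfolding N_def by (simp add: Suc_leI)
  obtain c where c: "0 < c" "\<And>r. s \<le> r \<Longrightarrow> r \<le> b - \<epsilon> \<Longrightarrow> c \<le> f r"
    using f_lower_bound[of s "b - \<epsilon>"] assms by auto
  \<comment> \<open>At this radius the paraboloid has fallen from \<open>b - \<epsilon>\<close> to
    \<open>a - \<epsilon>\<close>, below every solution.\<close>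
  define R where "R = sqrt (4 * N * (b - a) / c)"
  have R: "0 < R" "R\<^sup>2 = 4 * N * (b - a) / c" using c N ab by (auto simp: R_def)
  have "b - \<epsilon> \<le> u x" if u: "solution D u" and D: "cball x R \<subseteq> D" and s: "\<And>y. y \<in> cball x R \<Longrightarrow> s \<le> u y"
    for D and u :: "real^'n \<Rightarrow> real" and x
  proof -
    define h where "h = (\<lambda>q. b - \<epsilon> - c / (4 * N) * q)"
    have "h ((norm (x - x))\<^sup>2) \<le> u x"
    proof (rule radial_comparison[where K = "cball x R" and U = "ball x R" and
          h' = "\<lambda>_. - c / (4 * N)" and h'' = "\<lambda>_. 0"])
      show "continuous_on (cball x R) u" using solution_continuous[OF u] D continuous_on_subset by blast
      show "continuous_on ((\<lambda>y. (norm (y - x))\<^sup>2) ` cball x R) h"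
        unfolding h_def by (intro continuous_intros)
      show "has_lap u y (- f (u y))" if "y \<in> ball x R" for y
        using solution_has_lap[OF u, of y] D that ball_subset_cball by blast
      show "\<forall>\<^sub>F r in nhds ((norm (y - x))\<^sup>2). (h has_real_derivative - c / (4 * N)) (at r)" for y
        unfolding h_def using N by (intro always_eventually allI) (auto intro!: derivative_eq_intros)
      show "h ((norm (y - x))\<^sup>2) \<le> u y" if "y \<in> cball x R - ball x R" for y
      proof -
        have "norm (y - x) = R" using that by (auto simp: dist_norm norm_minus_commute)
        then have "h ((norm (y - x))\<^sup>2) = a - \<epsilon>" using R(2) c N by (simp add: h_def)
        then show ?thesis using s[of y] that assms by simp
      qed
      show "- f (u y) < 2 * real CARD('n) * (- c / (4 * N)) + 4 * q * 0"
        if "y \<in> ball x R" "q = (norm (y - x))\<^sup>2" "u y < h q" for y q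
      proof -
        have "h q \<le> b - \<epsilon>" using that(2) c N by (simp add: h_def)
        then have "c \<le> f (u y)" using c(2)[of "u y"] s[of y] that by simp
        moreover have "2 * N * (- c / (4 * N)) = - c / 2" using N by simp
        ultimately show ?thesis using c(1) by (simp add: N_def)
      qed
    qed (use R in auto)
    then show ?thesis by (simp add: h_def)
  qed
  then show ?thesis using that R(1) by blast
qed

lemma solution_bounded_away:
  fixes u :: "real^'n \<Rightarrow> real"
  assumes u: "solution UNIV u" and "a < s" "\<And>y. s \<le> u y"
  shows "u x = b"
proof -
  have "b \<le> u x + \<epsilon>" if \<epsilon>: "0 < \<epsilon>" for \<epsilon>
  proof -
    obtain R where "0 < R" and R: "\<And>D (u :: real^'n \<Rightarrow> real) x. solution D u \<Longrightarrow> cball x R \<subseteq> D \<Longrightarrow>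
        (\<And>y. y \<in> cball x R \<Longrightarrow> s \<le> u y) \<Longrightarrow> b - \<epsilon> \<le> u x"
      by (rule solution_near_b[OF \<open>a < s\<close> \<epsilon>, where 'n = 'n]) blast
    from R[OF u, of x] show ?thesis using assms(3) by simp
  qed
  then have "b \<le> u x" by (rule field_le_epsilon)
  then show ?thesis using solution_range[OF u, of x] by simp
qed

end

section \<open>Sweeping by bumps\<close>

text \<open>A segment from \<open>x\<close> to a point outside \<open>D\<close> meets the frontier
  no farther away than that point. An empty frontier, with distance infinity, is covered by the same
  argument.\<close>

lemma cball_subset_far_from_boundary:
  assumes "x \<in> D" "ereal M < boundary_dist D x"
  shows "cball x M \<subseteq> D"
proof
  fix y assume y: "y \<in> cball x M"
  show "y \<in> D"
  proof (rule ccontr)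
    assume "y \<notin> D"
    then obtain z where z: "z \<in> closed_segment x y" "z \<in> frontier D"
      using connected_Int_frontier[of "closed_segment x y" D] assms(1) by (auto simp: disjoint_iff)
    have "dist x z \<le> M"
      using dist_in_closed_segment[OF z(1)] y by (simp add: dist_commute)
    moreover have "ereal M < ereal (dist x z)"
      using less_INF_D[OF assms(2)[unfolded boundary_dist_def] z(2)] .
    ultimately show False by simp
  qed
qed

text \<open>The base is negative when \<open>q\<close> exceeds \<open>Q\<close>; the odd exponent
  preserves order there as well, so no restriction to the ball is required.\<close>

lemma bump_le_one: "0 \<le> q \<Longrightarrow> 0 < Q \<Longrightarrow> (1 - q / Q) ^ 3 \<le> (1::real)"
  using power_mono_odd[of 3 "1 - q / Q" 1] by simp

context potential
begin

text \<open>The comparison functions are the bumps \<open>a + k (1 - |y - c|\<^sup>2/Q)\<^sup>3\<close>, which lie below \<open>a\<close> off the ball of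
  radius \<open>\<surd>Q\<close> about \<open>c\<close>. The Laplacian is nonnegative where \<open>1 - |y - c|\<^sup>2/Q \<le> 4/(n+4)\<close>, and at least \<open>-6nk/Q\<close>
  elsewhere, so that under the hypothesis on \<open>f\<close> a bump below \<open>u\<close> can never touch \<open>u\<close>
  while \<open>c\<close>, \<open>k\<close> and \<open>Q\<close> move continuously.\<close>

lemma bump_sweep:
  fixes u :: "real^'n \<Rightarrow> real" and c :: "real \<Rightarrow> real^'n" and k Q :: "real \<Rightarrow> real"
  assumes u: "solution D u" and K: "compact K" "K \<subseteq> D" and u_gt: "\<And>y. y \<in> K \<Longrightarrow> a < u y"
    and cont: "continuous_on {0..1} c" "continuous_on {0..1} k" "continuous_on {0..1} Q"
    and k: "\<And>t. t \<in> {0..1} \<Longrightarrow> 0 < k t" "\<And>t. t \<in> {0..1} \<Longrightarrow> k t < b - a"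
    and Q: "\<And>t. t \<in> {0..1} \<Longrightarrow> 0 < Q t"
    and ball: "\<And>t. t \<in> {0..1} \<Longrightarrow> ball (c t) (sqrt (Q t)) \<subseteq> K"
    and sub: "\<And>t s. t \<in> {0..1} \<Longrightarrow> k t * (4 / (real CARD('n) + 4)) ^ 3 \<le> s \<Longrightarrow> s \<le> k t \<Longrightarrow>
      6 * real CARD('n) * k t / Q t < f (a + s)"
    and start: "\<And>y. y \<in> K \<Longrightarrow> a + k 0 * (1 - (norm (y - c 0))\<^sup>2 / Q 0) ^ 3 < u y"
  shows "a + k 1 < u (c 1)"
proof -
  define \<Phi> where "\<Phi> = (\<lambda>t y. a + k t * (1 - (norm (y - c t))\<^sup>2 / Q t) ^ 3)"
  \<comment> \<open>Stated for composites because continuity is used both jointly in time and space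
    and in time alone at a fixed point.\<close>
  have cont_\<Phi>: "continuous_on S (\<lambda>z. \<Phi> (\<tau> z) (y z))"
    if "continuous_on S \<tau>" "continuous_on S y" "\<tau> ` S \<subseteq> {0..1}" for \<tau> y and S :: "'a::topological_space set"
    unfolding \<Phi>_def
    using that Q
    by (intro continuous_intros continuous_on_compose2[OF cont(1)] continuous_on_compose2[OF cont(2)]
        continuous_on_compose2[OF cont(3)]) force+
  have below: "\<Phi> t y < u y" if "t \<in> {0..1}" "y \<in> K" for t y
  proof (rule ccontr)
    assume "\<not> \<Phi> t y < u y"
    \<comment> \<open>The set of contacts in time and space is compact, so there is a first contact
      time.\<close>
    define Z where "Z = {z \<in> {0..1} \<times> K. u (snd z) \<le> \<Phi> (fst z) (snd z)}"
    have "closed Z"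
      unfolding Z_def
    proof (rule continuous_on_closed_Collect_le)
      show "continuous_on ({0..1} \<times> K) (\<lambda>z. u (snd z))"
        by (rule continuous_on_compose2[OF solution_continuous[OF u]])
           (use K in \<open>auto intro: continuous_intros\<close>)
      show "continuous_on ({0..1} \<times> K) (\<lambda>z. \<Phi> (fst z) (snd z))"
        by (rule cont_\<Phi>) (auto intro: continuous_intros)
      show "closed ({0..1::real} \<times> K)" using K by (intro closed_Times compact_imp_closed) auto
    qed
    moreover have "Z = ({0..1} \<times> K) \<inter> Z" by (auto simp: Z_def)
    ultimately have "compact Z" using K by (metis compact_Int_closed compact_Times compact_Icc)
    moreover have "(t, y) \<in> Z" using that \<open>\<not> \<Phi> t y < u y\<close> by (simp add: Z_def)
    ultimately obtain z where z: "z \<in> Z" "\<And>z'. z' \<in> Z \<Longrightarrow> fst z \<le> fst z'"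
      using continuous_attains_inf[of Z fst] continuous_on_fst[OF continuous_on_id] by blast
    obtain t0 y0 where z_eq: "z = (t0, y0)" by (cases z)
    have 0: "t0 \<in> {0..1}" "y0 \<in> K" "u y0 \<le> \<Phi> t0 y0" using z(1) by (auto simp: Z_def z_eq)
    have "t0 \<noteq> 0" using 0 start[of y0] by (auto simp: \<Phi>_def)
    \<comment> \<open>Before \<open>t0\<close> the bump is strictly below \<open>u\<close>; the weak
      inequality survives in the limit.\<close>
    have le: "\<Phi> t0 y' \<le> u y'" if "y' \<in> K" for y'
    proof -
      have "0 \<le> u y' - \<Phi> t0 y'"
      proof (rule continuous_ge_on_closure[where S = "{0..<t0}" and f = "\<lambda>s. u y' - \<Phi> s y'"])
        show "continuous_on (closure {0..<t0}) (\<lambda>s. u y' - \<Phi> s y')"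
          using 0 \<open>t0 \<noteq> 0\<close> by (intro continuous_intros cont_\<Phi>) auto
        show "t0 \<in> closure {0..<t0}" using 0 \<open>t0 \<noteq> 0\<close> by simp
        show "0 \<le> u y' - \<Phi> s y'" if "s \<in> {0..<t0}" for s
          using z(2)[of "(s, y')"] that \<open>y' \<in> K\<close> 0 by (force simp: Z_def z_eq)
      qed
      then show ?thesis by simp
    qed
    \<comment> \<open>At the contact the bump equals \<open>u\<close>, hence exceeds
      \<open>a\<close>, so \<sigma> is positive. The contact therefore lies in the open ball of the
      bump, which makes it an interior point of \<open>K\<close> where the second derivative test is
      available.\<close>
    define \<sigma> where "\<sigma> = 1 - (norm (y0 - c t0))\<^sup>2 / Q t0"
    have u0: "u y0 = a + k t0 * \<sigma> ^ 3" using le[OF 0(2)] 0(3) by (simp add: \<Phi>_def \<sigma>_def)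
    have k0: "0 < k t0" and Q0: "0 < Q t0" using k Q 0(1) by auto
    have \<sigma>: "0 < \<sigma>" "\<sigma> \<le> 1"
    proof -
      have "0 < k t0 * \<sigma> ^ 3" using u0 u_gt[OF 0(2)] by simp
      then have "0 < \<sigma> ^ 3" using k0 by (simp add: zero_less_mult_iff)
      then show "0 < \<sigma>" by (simp add: zero_less_power_eq)
      show "\<sigma> \<le> 1" using Q0 by (simp add: \<sigma>_def)
    qed
    define B where "B = ball (c t0) (sqrt (Q t0))"
    have "(norm (y0 - c t0))\<^sup>2 < (sqrt (Q t0))\<^sup>2" using \<sigma>(1) Q0 by (simp add: \<sigma>_def)
    then have y0B: "y0 \<in> B" using Q0 unfolding B_def
      by (subst (asm) square_norm_less_iff) (auto simp: dist_norm norm_minus_commute)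
    have BK: "open B" "B \<subseteq> K" using ball[OF 0(1)] by (auto simp: B_def)
    define h' where "h' = (\<lambda>s. - 3 * k t0 / Q t0 * (1 - s / Q t0)\<^sup>2)"
    define h'' where "h'' = 6 * k t0 / (Q t0)\<^sup>2 * \<sigma>"
    define q where "q = (norm (y0 - c t0))\<^sup>2"
    have "has_lap (\<Phi> t0) y0 (2 * real CARD('n) * h' q + 4 * q * h'')"
      unfolding \<Phi>_def q_def
    proof (rule has_lap_radial[where h = "\<lambda>s. a + k t0 * (1 - s / Q t0) ^ 3"])
      show "\<forall>\<^sub>F s in nhds ((norm (y0 - c t0))\<^sup>2).
          ((\<lambda>s. a + k t0 * (1 - s / Q t0) ^ 3) has_real_derivative h' s) (at s)"
        unfolding h'_def using Q0
        by (intro always_eventually allI) (auto intro!: derivative_eq_intros)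
      show "(h' has_real_derivative h'') (at ((norm (y0 - c t0))\<^sup>2))"
        unfolding h'_def h''_def \<sigma>_def using Q0
        by (auto intro!: derivative_eq_intros simp: power2_eq_square field_simps)
    qed
    then have lap: "has_lap (\<lambda>y. u y - \<Phi> t0 y) y0 (- f (u y0) - (2 * real CARD('n) * h' q + 4 * q * h''))"
      using solution_has_lap[OF u, of y0] 0(2) K by (intro has_lap_diff) auto
    have "\<forall>\<^sub>F y in nhds y0. u y0 - \<Phi> t0 y0 \<le> u y - \<Phi> t0 y"
      using eventually_nhds_in_open[OF BK(1) y0B]
    proof eventually_elim
      case (elim y)
      then show ?case using le[of y] 0(3) BK by auto
    qed
    from has_lap_min[OF lap this]
    have "f (u y0) \<le> - (2 * real CARD('n) * h' q + 4 * q * h'')" by simp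
    also have "\<dots> = k t0 / Q t0 * (\<sigma> * (6 * real CARD('n) * \<sigma> - 24 * (1 - \<sigma>)))"
    proof -
      have "q = Q t0 * (1 - \<sigma>)" using Q0 by (simp add: \<sigma>_def q_def)
      then have "4 * q * h'' = 24 * k t0 / Q t0 * (1 - \<sigma>) * \<sigma>"
        using Q0 by (simp add: h''_def power2_eq_square)
      moreover have "h' q = - 3 * k t0 / Q t0 * \<sigma>\<^sup>2" by (simp add: h'_def \<sigma>_def q_def)
      ultimately show ?thesis by (simp only:) (simp add: algebra_simps power2_eq_square diff_divide_distrib)
    qed
    finally have f_le: "f (u y0) \<le> k t0 / Q t0 * (\<sigma> * (6 * real CARD('n) * \<sigma> - 24 * (1 - \<sigma>)))" .
    have \<sigma>3: "\<sigma> ^ 3 \<le> 1" using \<sigma> by (simp add: power_le_one)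
    \<comment> \<open>The bracket 6n\<sigma> - 24(1 - \<sigma>) changes sign at \<sigma> = 4/(n+4).
      Below this value positivity of f(u) is enough; above it the contact height is at least the
      fraction (4/(n+4))^3 of \<open>k\<close>, where \<open>sub\<close> applies.\<close>
    show False
    proof (cases "\<sigma> \<le> 4 / (real CARD('n) + 4)")
      case True
      then have "6 * real CARD('n) * \<sigma> - 24 * (1 - \<sigma>) \<le> 0" by (simp add: field_simps)
      then have le0: "\<sigma> * (6 * real CARD('n) * \<sigma> - 24 * (1 - \<sigma>)) \<le> 0" using \<sigma> by (simp add: mult_le_0_iff)
      have "k t0 / Q t0 * (\<sigma> * (6 * real CARD('n) * \<sigma> - 24 * (1 - \<sigma>))) \<le> 0"
        by (rule mult_nonneg_nonpos[OF _ le0]) (use k0 Q0 in simp)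
      moreover have "0 < f (u y0)"
      proof (rule f_pos)
        show "a < u y0" by (rule u_gt[OF 0(2)])
        have "k t0 * \<sigma> ^ 3 \<le> k t0 * 1" using \<sigma>3 k0 by (intro mult_left_mono) auto
        then show "u y0 < b" using u0 k(2)[OF 0(1)] by simp
      qed
      ultimately show False using f_le by simp
    next
      case False
      have "6 * real CARD('n) * k t0 / Q t0 < f (a + k t0 * \<sigma> ^ 3)"
      proof (rule sub[OF 0(1)])
        show "k t0 * (4 / (real CARD('n) + 4)) ^ 3 \<le> k t0 * \<sigma> ^ 3"
          using False k0 by (intro mult_left_mono power_mono) auto
        show "k t0 * \<sigma> ^ 3 \<le> k t0" using \<sigma>3 k0 by simp
      qed
      moreover have "\<sigma> * (6 * real CARD('n) * \<sigma> - 24 * (1 - \<sigma>)) \<le> 1 * (6 * real CARD('n))"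
      proof -
        have "6 * real CARD('n) * \<sigma> - 24 * (1 - \<sigma>) \<le> 6 * real CARD('n) * 1 - 0"
          using \<sigma> by (intro diff_mono mult_left_mono) auto
        then have "\<sigma> * (6 * real CARD('n) * \<sigma> - 24 * (1 - \<sigma>)) \<le> \<sigma> * (6 * real CARD('n))"
          using \<sigma> by (intro mult_left_mono) auto
        also have "\<dots> \<le> 1 * (6 * real CARD('n))" using \<sigma> by (intro mult_right_mono) auto
        finally show ?thesis .
      qed
      then have "k t0 / Q t0 * (\<sigma> * (6 * real CARD('n) * \<sigma> - 24 * (1 - \<sigma>))) \<le> k t0 / Q t0 * (1 * (6 * real CARD('n)))"
        using k0 Q0 by (intro mult_left_mono) auto
      ultimately show False using f_le u0 by (simp add: field_simps)
    qed
  qed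
  have "c 1 \<in> K" using ball[of 1] Q[of 1] by (auto simp: subset_iff)
  then show ?thesis using below[of 1 "c 1"] by (simp add: \<Phi>_def)
qed

text \<open>Under the linear bound both sides of the sweeping condition 6nk/R^2 < C0 \<theta> k are
  proportional to \<open>k\<close>. So one radius serves all heights, and \<open>R\<close> does not
  depend on how close \<open>u\<close> is to \<open>a\<close>.\<close>

lemma linear_growth_lower_bound:
  assumes "0 < C0" "a < s0" "s0 < b" and lin: "\<And>s. a \<le> s \<Longrightarrow> s \<le> s0 \<Longrightarrow> C0 * (s - a) \<le> f s"
  obtains R where "0 < R"
    "\<And>D (u :: real^'n \<Rightarrow> real) x. solution D u \<Longrightarrow> cball x R \<subseteq> D \<Longrightarrow> (\<And>y. y \<in> cball x R \<Longrightarrow> a < u y) \<Longrightarrow>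
       s0 < u x"
proof -
  define \<theta> where "\<theta> = (4 / (real CARD('n) + 4)) ^ 3"
  have \<theta>: "0 < \<theta>" by (simp add: \<theta>_def)
  define R where "R = sqrt (6 * real CARD('n) / (C0 * \<theta>) + 1)"
  have R: "0 < R" "6 * real CARD('n) / (C0 * \<theta>) < R\<^sup>2"
    using assms \<theta> by (auto simp: R_def intro!: add_nonneg_pos)
  have "s0 < u x" if u: "solution D u" and D: "cball x R \<subseteq> D" and gt: "\<And>y. y \<in> cball x R \<Longrightarrow> a < u y"
    for D and u :: "real^'n \<Rightarrow> real" and x
  proof -
    have "continuous_on (cball x R) u" using solution_continuous[OF u] D continuous_on_subset by blast
    then obtain y0 where y0: "y0 \<in> cball x R" "\<And>y. y \<in> cball x R \<Longrightarrow> u y0 \<le> u y"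
      using continuous_attains_inf[of "cball x R" u] R by auto
    \<comment> \<open>The initial height depends on the minimum of \<open>u\<close> over the ball,
      which is positive but not controlled; only the start of the sweep uses it.\<close>
    define k0 where "k0 = min ((u y0 - a) / 2) (s0 - a)"
    have k0: "0 < k0" "a + k0 < u y0" "k0 \<le> s0 - a"
      using gt[OF y0(1)] assms by (auto simp: k0_def min_def field_simps)
    define k where "k = (\<lambda>t. (1 - t) * k0 + t * (s0 - a))"
    have k: "0 < k t" "k t \<le> s0 - a" if "t \<in> {0..1}" for t
    proof -
      have "k0 \<le> k t"
        using convex_bound_le[of "- k0" "- k0" "- (s0 - a)" "1 - t" t] that k0 by (simp add: k_def algebra_simps)
      then show "0 < k t" using k0 by simp
      show "k t \<le> s0 - a"
        unfolding k_def using that k0 by (intro convex_bound_le) auto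
    qed
    have "a + k 1 < u ((\<lambda>_. x) (1::real))"
    proof (rule bump_sweep[OF u _ D gt, where Q = "\<lambda>_. R\<^sup>2"])
      show "continuous_on {0..1} k" unfolding k_def by (intro continuous_intros)
      fix t :: real assume t: "t \<in> {0..1}"
      show "0 < k t" using k[OF t] by simp
      show "k t < b - a" using k[OF t] assms by simp
      show "ball x (sqrt (R\<^sup>2)) \<subseteq> cball x R" using R by auto
      fix s assume "k t * (4 / (real CARD('n) + 4)) ^ 3 \<le> s" and s: "s \<le> k t"
      then have s': "k t * \<theta> \<le> s" by (simp add: \<theta>_def)
      have "0 \<le> k t * \<theta>" using k(1)[OF t] \<theta> by simp
      have "6 * real CARD('n) < C0 * \<theta> * R\<^sup>2" using R(2) assms \<theta> by (simp add: field_simps)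
      then have "k t * (6 * real CARD('n)) < k t * (C0 * \<theta> * R\<^sup>2)"
        using k(1)[OF t] by (intro mult_strict_left_mono)
      then have "6 * real CARD('n) * k t / R\<^sup>2 < C0 * (k t * \<theta>)"
        using R(1) by (simp add: pos_divide_less_eq mult_ac)
      also have "\<dots> \<le> C0 * s" using s' assms by (intro mult_left_mono) auto
      also have "\<dots> \<le> f (a + s)"
        using lin[of "a + s"] s s' \<open>0 \<le> k t * \<theta>\<close> k[OF t] by simp
      finally show "6 * real CARD('n) * k t / R\<^sup>2 < f (a + s)" .
    next
      fix y assume "y \<in> cball x R"
      have "k0 * (1 - (norm (y - x))\<^sup>2 / R\<^sup>2) ^ 3 \<le> k0 * 1"
        using bump_le_one[of "(norm (y - x))\<^sup>2" "R\<^sup>2"] R k0 by (intro mult_left_mono) auto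
      then have "a + k0 * (1 - (norm (y - x))\<^sup>2 / R\<^sup>2) ^ 3 < u y"
        using y0(2)[OF \<open>y \<in> cball x R\<close>] k0 by linarith
      then show "a + k 0 * (1 - (norm (y - x))\<^sup>2 / R\<^sup>2) ^ 3 < u y" by (simp add: k_def)
    qed (use R in auto)
    then show ?thesis by (simp add: k_def)
  qed
  then show ?thesis using that R(1) by blast
qed

lemma tends_to_far_from_boundary_b:
  fixes u :: "real^'n \<Rightarrow> real"
  assumes u: "solution D u" and gt: "\<And>y. y \<in> D \<Longrightarrow> a < u y"
    and "0 < C0" "a < s0" "s0 < b" and lin: "\<And>s. a \<le> s \<Longrightarrow> s \<le> s0 \<Longrightarrow> C0 * (s - a) \<le> f s"
  shows "tends_to_far_from_boundary D u b"
  unfolding tends_to_far_from_boundary_def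
proof (intro allI impI)
  fix \<epsilon> :: real assume "0 < \<epsilon>"
  obtain R1 where R1: "0 < R1" "\<And>D (u :: real^'n \<Rightarrow> real) x. solution D u \<Longrightarrow> cball x R1 \<subseteq> D \<Longrightarrow>
      (\<And>y. y \<in> cball x R1 \<Longrightarrow> a < u y) \<Longrightarrow> s0 < u x"
    by (rule linear_growth_lower_bound[OF assms(3-6), where 'n = 'n]) blast+
  obtain R2 where R2: "0 < R2" "\<And>D (u :: real^'n \<Rightarrow> real) x. solution D u \<Longrightarrow> cball x R2 \<subseteq> D \<Longrightarrow>
      (\<And>y. y \<in> cball x R2 \<Longrightarrow> s0 \<le> u y) \<Longrightarrow> b - \<epsilon> / 2 \<le> u x"
    by (rule solution_near_b[OF \<open>a < s0\<close>, of "\<epsilon> / 2", where 'n = 'n]) (use \<open>0 < \<epsilon>\<close> in auto)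
  show "\<exists>M>0. \<forall>x\<in>D. ereal M < boundary_dist D x \<longrightarrow> \<bar>u x - b\<bar> < \<epsilon>"
  proof (intro exI conjI ballI impI)
    \<comment> \<open>Each point at distance at most \<open>R2\<close> from \<open>x\<close> is
      still the centre of a ball of radius \<open>R1\<close> in \<open>D\<close>. This gives
      \<open>s0 < u\<close> on the whole \<open>R2\<close>-ball, from which \<open>u\<close> is
      close to \<open>b\<close> at its centre.\<close>
    show "0 < R1 + R2" using R1 R2 by simp
    fix x assume x: "x \<in> D" "ereal (R1 + R2) < boundary_dist D x"
    have D: "cball x (R1 + R2) \<subseteq> D" by (rule cball_subset_far_from_boundary[OF x])
    have "b - \<epsilon> / 2 \<le> u x"
    proof (rule R2(2)[OF u])
      show "cball x R2 \<subseteq> D" using D R1(1) by (auto simp: subset_iff)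
      fix y assume y: "y \<in> cball x R2"
      have "cball y R1 \<subseteq> cball x (R1 + R2)"
      proof
        fix z assume "z \<in> cball y R1"
        then show "z \<in> cball x (R1 + R2)" using y dist_triangle[of x z y] by simp
      qed
      then have "cball y R1 \<subseteq> D" using D by blast
      then have "s0 < u y" using R1(2)[OF u, of y] gt by blast
      then show "s0 \<le> u y" by simp
    qed
    then show "\<bar>u x - b\<bar> < \<epsilon>"
      using solution_range[OF u x(1)] \<open>0 < \<epsilon>\<close> by auto
  qed
qed

end

section \<open>Interior Lipschitz estimate\<close>

lemma has_lap_translate:
  assumes "has_lap u (p + x) l"
  shows "has_lap (\<lambda>z. u (p + z)) x l"
  using assms unfolding has_lap_def by (simp add: add.assoc)

definition reflect :: "'n \<Rightarrow> real^'n \<Rightarrow> real^'n" where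
  "reflect i z = z - (2 * z $ i) *\<^sub>R axis i 1"

lemma reflect_add_axis:
  "reflect i (x + t *\<^sub>R axis j 1) = reflect i x + (if i = j then - t else t) *\<^sub>R axis j 1"
  by (auto simp: reflect_def vec_eq_iff axis_def algebra_simps)

lemma has_lap_reflect:
  assumes "has_lap u (reflect i x) l"
  shows "has_lap (\<lambda>z. u (reflect i z)) x l"
proof -
  obtain d where d: "\<And>j. has_second_deriv0 (\<lambda>t. u (reflect i x + t *\<^sub>R axis j 1)) (d j)" "l = sum d UNIV"
    using assms unfolding has_lap_def by auto
  have "has_second_deriv0 (\<lambda>t. u (reflect i (x + t *\<^sub>R axis j 1))) (d j)" for j
    using d(1)[of j] has_second_deriv0_reflect[OF d(1)[of j]]
    by (cases "i = j") (auto simp: reflect_add_axis)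
  then show ?thesis unfolding has_lap_def using d(2) by blast
qed

text \<open>The interior gradient bound for the Poisson equation by comparison on a half ball
  (A. Brandt; see Section 3.4 of the book of Gilbarg and Trudinger): the odd part of \<open>u\<close> with respect to the
  hyperplane through \<open>p\<close> vanishes on the flat part of the boundary.\<close>

lemma reflected_difference_bound:
  fixes u :: "real^'n \<Rightarrow> real"
  assumes cont: "continuous_on UNIV u" and lap: "\<And>x. has_lap u x (l x)" "\<And>x. \<bar>l x\<bar> \<le> K"
    and osc: "\<And>x y. \<bar>u x - u y\<bar> \<le> M" and t: "0 \<le> t" "t \<le> 1"
  shows "u (p + t *\<^sub>R axis i 1) - u (p - t *\<^sub>R axis i 1) \<le> (2 * M + M * real CARD('n) + K + 1) * t"
proof -
  \<comment> \<open>With this value the Laplacian 2Mn - 2E of \<psi> is -2K - 2, which beats the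
    Laplacian of the odd part \<phi>, bounded by 2K in absolute value.\<close>
  define E where "E = M * real CARD('n) + K + 1"
  have K: "0 \<le> K" and M: "0 \<le> M" using lap(2)[of 0] osc[of 0 0] by auto
  have E: "0 \<le> E" "M \<le> E"
  proof -
    have "M * 1 \<le> M * real CARD('n)" using M by (intro mult_left_mono) (auto simp: Suc_leI)
    then show "M \<le> E" using K by (simp add: E_def)
    then show "0 \<le> E" using M by simp
  qed
  \<comment> \<open>The term M |z|^2 dominates the odd part on the spherical boundary, where it
    equals \<open>M\<close>. The other term is nonnegative on the half ball, vanishes on the flat
    side, and supplies the negative Laplacian at a cost linear in \<open>t\<close> along the
    axis.\<close>
  define \<psi> :: "real^'n \<Rightarrow> real" where "\<psi> = (\<lambda>z. M * (norm z)\<^sup>2 + E * (z $ i) * (1 - z $ i))"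
  define \<phi> where "\<phi> = (\<lambda>z. u (p + z) - u (p + reflect i z))"
  define S where "S = cball 0 1 \<inter> {z :: real^'n. 0 \<le> z $ i}"
  define U where "U = ball 0 1 \<inter> {z :: real^'n. 0 < z $ i}"
  have "0 \<le> \<psi> z - \<phi> z" if "z \<in> S" for z
  proof (rule comparison_nonneg[OF _ _ _ _ _ _ that])
    show "compact S" unfolding S_def
      by (intro compact_Int_closed compact_cball closed_Collect_le continuous_intros)
    show "open U" unfolding U_def
      by (intro open_Int open_ball open_Collect_less continuous_intros)
    show "U \<subseteq> S" by (auto simp: U_def S_def)
    show "continuous_on S (\<lambda>z. \<psi> z - \<phi> z)"
      unfolding \<psi>_def \<phi>_def reflect_def
      by (intro continuous_intros continuous_on_compose2[OF cont]) auto
  next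
    fix y assume y: "y \<in> S - U"
    have yi: "0 \<le> y $ i" "y $ i \<le> 1"
      using y component_le_norm_cart[of y i] by (auto simp: S_def)
    have "y $ i = 0 \<or> norm y = 1" using y by (auto simp: S_def U_def)
    then show "0 \<le> \<psi> y - \<phi> y"
    proof
      assume "y $ i = 0"
      then show ?thesis using M by (simp add: \<psi>_def \<phi>_def reflect_def)
    next
      assume "norm y = 1"
      then have "M \<le> \<psi> y" using E yi by (simp add: \<psi>_def)
      moreover have "\<phi> y \<le> M" using osc[of "p + y" "p + reflect i y"] by (simp add: \<phi>_def)
      ultimately show ?thesis by simp
    qed
  next
    fix y
    have "has_lap \<psi> y (2 * M * real CARD('n) - 2 * E)"
      unfolding has_lap_def
    proof (intro exI[of _ "\<lambda>j. 2 * (M - (if i = j then E else 0))"] conjI allI)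
      fix j
      define \<delta> :: real where "\<delta> = (if i = j then 1 else 0)"
      have \<delta>: "\<delta> * \<delta> = \<delta>" by (simp add: \<delta>_def)
      have comp: "(y + t *\<^sub>R axis j 1) $ i = y $ i + \<delta> * t" for t by (auto simp: axis_def \<delta>_def)
      have "\<psi> (y + t *\<^sub>R axis j 1) =
          M * ((norm y)\<^sup>2 + 2 * y $ j * t + t\<^sup>2) + E * (y $ i + \<delta> * t) * (1 - (y $ i + \<delta> * t))" for t
        by (simp only: \<psi>_def norm_add_axis_sq comp)
      also have "\<dots> t = \<psi> y + (2 * M * y $ j + E * \<delta> * (1 - 2 * y $ i)) * t + (M - E * \<delta>) * t\<^sup>2" for t
      proof -
        have "E * (y $ i + \<delta> * t) * (1 - (y $ i + \<delta> * t)) =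
            E * (y $ i) * (1 - y $ i) + E * \<delta> * (1 - 2 * y $ i) * t - E * (\<delta> * \<delta>) * t\<^sup>2"
          by (simp add: algebra_simps power2_eq_square)
        then show ?thesis unfolding \<delta> by (simp add: \<psi>_def algebra_simps)
      qed
      finally have "\<psi> (y + t *\<^sub>R axis j 1) =
          \<psi> y + (2 * M * y $ j + E * \<delta> * (1 - 2 * y $ i)) * t + (M - E * \<delta>) * t\<^sup>2" for t .
      then show "has_second_deriv0 (\<lambda>t. \<psi> (y + t *\<^sub>R axis j 1)) (2 * (M - (if i = j then E else 0)))"
        using has_second_deriv0_quadratic[of "\<psi> y" "2 * M * y $ j + E * \<delta> * (1 - 2 * y $ i)" "M - E * \<delta>"]
        by (simp add: \<delta>_def if_distrib cong: if_cong)
    next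
      show "2 * M * real CARD('n) - 2 * E = (\<Sum>j\<in>UNIV. 2 * (M - (if i = j then E else 0)))"
        by (simp add: sum_subtractf right_diff_distrib sum_distrib_left[symmetric])
    qed
    moreover have "has_lap \<phi> y (l (p + y) - l (p + reflect i y))"
      unfolding \<phi>_def by (intro has_lap_diff has_lap_translate lap(1) has_lap_reflect[where u = "\<lambda>z. u (p + z)"])
    ultimately have "has_lap (\<lambda>z. \<psi> z - \<phi> z) y (2 * M * real CARD('n) - 2 * E - (l (p + y) - l (p + reflect i y)))"
      by (rule has_lap_diff)
    moreover have "2 * M * real CARD('n) - 2 * E - (l (p + y) - l (p + reflect i y)) < 0"
      using lap(2)[of "p + y"] lap(2)[of "p + reflect i y"] by (simp add: E_def abs_le_iff)
    ultimately show "\<exists>l<0. has_lap (\<lambda>z. \<psi> z - \<phi> z) y l" by blast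
  qed
  moreover have "t *\<^sub>R axis i 1 \<in> S" using t by (simp add: S_def)
  ultimately have "0 \<le> \<psi> (t *\<^sub>R axis i 1) - \<phi> (t *\<^sub>R axis i 1)" by blast
  moreover have "reflect i (t *\<^sub>R axis i 1) = - (t *\<^sub>R axis i 1)"
    by (simp add: reflect_def vec_eq_iff axis_def)
  ultimately have "u (p + t *\<^sub>R axis i 1) - u (p - t *\<^sub>R axis i 1) \<le> M * t\<^sup>2 + E * t * (1 - t)"
    using t by (simp add: \<phi>_def \<psi>_def)
  also have "\<dots> \<le> M * t + E * t"
  proof -
    have "t\<^sup>2 \<le> t" using t by (simp add: power2_eq_square mult_left_le)
    then have "M * t\<^sup>2 \<le> M * t" using M by (rule mult_left_mono)
    moreover have "E * t * (1 - t) \<le> E * t" using E t by (simp add: mult_left_le)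
    ultimately show ?thesis by simp
  qed
  also have "\<dots> \<le> (2 * M + M * real CARD('n) + K + 1) * t"
    using M t by (simp add: E_def algebra_simps)
  finally show ?thesis .
qed

lemma poisson_lipschitz:
  fixes u :: "real^'n \<Rightarrow> real"
  assumes cont: "continuous_on UNIV u" and lap: "\<And>x. has_lap u x (l x)" "\<And>x. \<bar>l x\<bar> \<le> K"
    and osc: "\<And>x y. \<bar>u x - u y\<bar> \<le> M" and "dist y x \<le> 1"
  shows "\<bar>u y - u x\<bar> \<le> (2 * M + M * real CARD('n) + K + 1) * real CARD('n) * dist y x"
proof -
  define G where "G = 2 * M + M * real CARD('n) + K + 1"
  have K: "0 \<le> K" and M: "0 \<le> M" using lap(2)[of 0] osc[of 0 0] by auto
  then have G: "0 \<le> G" by (simp add: G_def)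
  have diff: "u (p + t *\<^sub>R axis i 1) - u (p - t *\<^sub>R axis i 1) \<le> G * t"
       "u (p - t *\<^sub>R axis i 1) - u (p + t *\<^sub>R axis i 1) \<le> G * t" if "0 \<le> t" "t \<le> 1" for p t i
  proof -
    show "u (p + t *\<^sub>R axis i 1) - u (p - t *\<^sub>R axis i 1) \<le> G * t"
      unfolding G_def by (rule reflected_difference_bound[OF cont lap osc that])
    \<comment> \<open>The opposite sign comes from -u, written as a difference so that the rules for
      constants and differences give its Laplacian.\<close>
    have "0 - u (p + t *\<^sub>R axis i 1) - (0 - u (p - t *\<^sub>R axis i 1)) \<le> G * t"
      unfolding G_def
    proof (rule reflected_difference_bound[where l = "\<lambda>x. 0 - l x"])
      show "continuous_on UNIV (\<lambda>x. 0 - u x)" using cont by (intro continuous_intros)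
      show "has_lap (\<lambda>x. 0 - u x) x (0 - l x)" for x by (intro has_lap_diff has_lap_const lap(1))
      show "\<bar>0 - l x\<bar> \<le> K" for x using lap(2)[of x] by simp
      show "\<bar>0 - u x - (0 - u y)\<bar> \<le> M" for x y using osc[of x y] by simp
    qed (rule that)+
    then show "u (p - t *\<^sub>R axis i 1) - u (p + t *\<^sub>R axis i 1) \<le> G * t" by simp
  qed
  have one: "\<bar>u (z + s *\<^sub>R axis i 1) - u z\<bar> \<le> G * \<bar>s\<bar>" if "\<bar>s\<bar> \<le> 1" for z s i
  proof -
    \<comment> \<open>Centring at the midpoint turns a symmetric difference into the difference
      between \<open>z + s e_i\<close> and \<open>z\<close>.\<close>
    define p where "p = z + (s / 2) *\<^sub>R axis i 1"
    have p: "p + (s / 2) *\<^sub>R axis i 1 = z + s *\<^sub>R axis i 1" "p - (s / 2) *\<^sub>R axis i 1 = z"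
      by (auto simp: p_def scaleR_add_left[symmetric] add.assoc)
    have "\<bar>u (z + s *\<^sub>R axis i 1) - u z\<bar> \<le> G * \<bar>s / 2\<bar>"
    proof (cases "0 \<le> s")
      case True
      then show ?thesis using diff[of "s / 2" p i] that unfolding p by linarith
    next
      case False
      have "p + (- s / 2) *\<^sub>R axis i 1 = z" "p - (- s / 2) *\<^sub>R axis i 1 = z + s *\<^sub>R axis i 1"
        using p by simp_all
      then show ?thesis using diff[of "- s / 2" p i] that False by (simp only:) linarith
    qed
    also have "\<dots> \<le> G * \<bar>s\<bar>" using G by (intro mult_left_mono) auto
    finally show ?thesis .
  qed
  define v where "v = y - x"
  have v: "\<bar>v $ i\<bar> \<le> dist y x" for i
    using component_le_norm_cart[of v i] by (simp add: v_def dist_norm)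
  \<comment> \<open>The way from \<open>x\<close> to \<open>y\<close> is walked one coordinate at a
    time, each step having length at most 1; hence the factor n in the final constant.\<close>
  have "\<bar>u (x + (\<Sum>j\<in>J. v $ j *\<^sub>R axis j 1)) - u x\<bar> \<le> (\<Sum>j\<in>J. G * \<bar>v $ j\<bar>)" if "finite J" for J
    using that
  proof induction
    case empty
    then show ?case by simp
  next
    case (insert j J)
    define z where "z = x + (\<Sum>j\<in>J. v $ j *\<^sub>R axis j 1)"
    have eq: "x + (\<Sum>j\<in>insert j J. v $ j *\<^sub>R axis j 1) = z + v $ j *\<^sub>R axis j 1"
      using insert.hyps by (simp add: z_def algebra_simps)
    have "\<bar>u (z + v $ j *\<^sub>R axis j 1) - u z\<bar> \<le> G * \<bar>v $ j\<bar>"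
      using v[of j] assms(5) by (intro one) simp
    moreover have "\<bar>u z - u x\<bar> \<le> (\<Sum>j\<in>J. G * \<bar>v $ j\<bar>)" using insert.IH by (simp only: z_def)
    ultimately show ?case unfolding eq unfolding sum.insert[OF insert.hyps] by linarith
  qed
  from this[of UNIV] have "\<bar>u y - u x\<bar> \<le> (\<Sum>j\<in>UNIV. G * \<bar>v $ j\<bar>)"
    using basis_expansion[of v] by (simp add: scalar_mult_eq_scaleR v_def)
  also have "\<dots> \<le> (\<Sum>j\<in>(UNIV :: 'n set). G * dist y x)"
    using G v by (intro sum_mono mult_left_mono) auto
  finally show ?thesis by (simp add: G_def mult_ac)
qed

section \<open>Entire solutions: the constant C_W and the limit inferior at infinity\<close>

context potential
begin

text \<open>All solutions take values in the same interval, so their oscillation and the right-hand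
  side have bounds free of \<open>u\<close>, and \<open>G\<close> is uniform over all entire
  solutions.\<close>

lemma entire_solution_lipschitz:
  obtains G where "0 < G"
    "\<And>(u :: real^'n \<Rightarrow> real) x y. solution UNIV u \<Longrightarrow> dist y x \<le> 1 \<Longrightarrow> \<bar>u y - u x\<bar> \<le> G * dist y x"
proof -
  obtain L where L: "0 \<le> L" "\<And>s t. s \<in> {a..b} \<Longrightarrow> t \<in> {a..b} \<Longrightarrow> \<bar>f s - f t\<bar> \<le> L * \<bar>s - t\<bar>"
    using f_lipschitz by blast
  define M where "M = b - a"
  define K where "K = L * M"
  define G where "G = (2 * M + M * real CARD('n) + K + 1) * real CARD('n)"
  have "0 < G" unfolding G_def using ab L(1)
    by (intro mult_pos_pos) (auto simp: M_def K_def intro!: add_nonneg_pos add_nonneg_nonneg)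
  moreover have "\<bar>u y - u x\<bar> \<le> G * dist y x" if u: "solution UNIV u" and "dist y x \<le> 1"
    for u :: "real^'n \<Rightarrow> real" and x y
    unfolding G_def
  proof (rule poisson_lipschitz[where l = "\<lambda>x. - f (u x)", OF solution_continuous[OF u]])
    show "has_lap u z (- f (u z))" for z using solution_has_lap[OF u] by simp
    show "\<bar>- f (u z)\<bar> \<le> K" for z
    proof -
      have "\<bar>f (u z) - f a\<bar> \<le> L * \<bar>u z - a\<bar>" using solution_range[OF u, of z] ab by (intro L(2)) auto
      also have "\<dots> \<le> L * M" using solution_range[OF u, of z] L(1) by (intro mult_left_mono) (auto simp: M_def)
      finally show ?thesis by (simp add: f_ends K_def)
    qed
    show "\<bar>u z - u z'\<bar> \<le> M" for z z'
      using solution_range[OF u UNIV_I, of z] solution_range[OF u UNIV_I, of z'] unfolding M_def by linarith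
  qed (rule that(2))
  ultimately show ?thesis using that by blast
qed

lemma solution_min_cball:
  fixes u :: "real^'n \<Rightarrow> real"
  assumes u: "solution UNIV u" and "\<And>y. a < u y"
  obtains m where "0 < m" "\<And>y. dist p y \<le> r \<Longrightarrow> a + m \<le> u y"
proof (cases "0 \<le> r")
  case True
  have "continuous_on (cball p r) u" using solution_continuous[OF u] continuous_on_subset by blast
  then obtain y0 where "y0 \<in> cball p r" "\<And>y. y \<in> cball p r \<Longrightarrow> u y0 \<le> u y"
    using continuous_attains_inf[of "cball p r" u] True by auto
  then show ?thesis using that[of "u y0 - a"] assms(2)[of y0] by simp
next
  case False
  then have "\<not> dist p y \<le> r" for y using zero_le_dist[of p y] by linarith
  then show ?thesis using that[of 1] by auto
qed

text \<open>A bump of the fixed height \<open>(b - a) / 2\<close> can be slid over the whole space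
  once it fits below \<open>u\<close> somewhere. A value of \<open>u\<close> above \<open>C\<close>
  provides such a place, and \<open>u\<close> is then bounded away from \<open>a\<close>.\<close>

lemma entire_solution_above:
  obtains C where "a < C" "C < b"
    "\<And>(u :: real^'n \<Rightarrow> real) x y. solution UNIV u \<Longrightarrow> (\<And>z. a < u z) \<Longrightarrow> C < u x \<Longrightarrow> u y = b"
proof -
  define n where "n = real CARD('n)"
  define k where "k = (b - a) / 2"
  define \<theta> where "\<theta> = (4 / (n + 4)) ^ 3"
  have n: "0 < n" by (simp add: n_def)
  have k: "0 < k" "k < b - a" using ab by (auto simp: k_def)
  have \<theta>: "0 < \<theta>" using n by (simp add: \<theta>_def)
  obtain c where c: "0 < c" "\<And>r. a + k * \<theta> \<le> r \<Longrightarrow> r \<le> a + k \<Longrightarrow> c \<le> f r"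
    using f_lower_bound[of "a + k * \<theta>" "a + k"] k \<theta> by auto
  \<comment> \<open>Chosen so that 6nk/Q < c, where \<open>c\<close> bounds \<open>f\<close> below
    at the heights between \<theta> k and k above \<open>a\<close>.\<close>
  define Q where "Q = 6 * n * k / c + 1"
  have Q: "0 < Q" "6 * n * k / Q < c"
  proof -
    have "0 \<le> 6 * n * k / c" using n k c by simp
    then show "0 < Q" by (simp add: Q_def)
    have "6 * n * k < c * Q" using c by (simp add: Q_def field_simps)
    then show "6 * n * k / Q < c" using \<open>0 < Q\<close> by (simp add: pos_divide_less_eq)
  qed
  define R where "R = sqrt Q"
  have R: "0 < R" "R\<^sup>2 = Q" using Q by (auto simp: R_def)
  obtain G where G: "0 < G"
    "\<And>(u :: real^'n \<Rightarrow> real) x y. solution UNIV u \<Longrightarrow> dist y x \<le> 1 \<Longrightarrow> \<bar>u y - u x\<bar> \<le> G * dist y x"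
    by (rule entire_solution_lipschitz[where 'n = 'n]) blast
  \<comment> \<open>Within distance \<rho> a solution changes by at most k/2. Since a + k = b - k, a
    point with value at most a + k therefore has a whole ball about it on which \<open>u\<close> is
    at most b - k/2.\<close>
  define \<rho> where "\<rho> = min 1 (k / (2 * G))"
  have \<rho>: "0 < \<rho>" "\<rho> \<le> 1" "G * \<rho> \<le> k / 2"
  proof -
    show "0 < \<rho>" "\<rho> \<le> 1" using k G(1) by (auto simp: \<rho>_def)
    have "G * \<rho> \<le> G * (k / (2 * G))" using G(1) by (intro mult_left_mono) (auto simp: \<rho>_def)
    then show "G * \<rho> \<le> k / 2" using G(1) by simp
  qed
  obtain c' where c': "0 < c'"
    "\<And>(u :: real^'n \<Rightarrow> real) y x. solution UNIV u \<Longrightarrow> (\<And>z. dist z y \<le> \<rho> \<Longrightarrow> u z \<le> b - k / 2) \<Longrightarrow>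
      dist x y \<le> R + 1 \<Longrightarrow> u x \<le> b - c'"
    by (rule quantitative_solution_eq_b[of "k / 2" \<rho> "R + 1", where 'n = 'n]) (use k \<rho> R in auto)
  \<comment> \<open>A value above b - c' excludes such a ball about any point within distance
    \<open>R\<close>; the maximum with a + k secures \<open>a < C\<close>.\<close>
  define C where "C = max (b - c') (a + k)"
  have "u x1 = b" if u: "solution UNIV u" and gt: "\<And>z. a < u z" and x0: "C < u x0"
    for u :: "real^'n \<Rightarrow> real" and x0 x1
  proof -
    have big: "a + k < u y" if y: "dist x0 y \<le> R" for y
    proof (rule ccontr)
      assume *: "\<not> a + k < u y"
      have "u x0 \<le> b - c'"
      proof (rule c'(2)[OF u])
        fix z assume z: "dist z y \<le> \<rho>"
        then have "\<bar>u z - u y\<bar> \<le> G * dist z y" using \<rho>(2) by (intro G(2)[OF u]) simp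
        also have "\<dots> \<le> G * \<rho>" using z G(1) by (intro mult_left_mono) auto
        finally have "u z \<le> u y + k / 2" using \<rho>(3) by simp
        then show "u z \<le> b - k / 2" using * by (simp add: k_def field_simps)
      qed (use y in simp)
      then show False using x0 by (simp add: C_def)
    qed
    have above: "a + k \<le> u x" for x
    proof -
      have "a + k < u (x0 + 1 *\<^sub>R (x - x0))"
      proof (rule bump_sweep[OF u, where K = "cball x0 (dist x0 x + R)" and c = "\<lambda>t. x0 + t *\<^sub>R (x - x0)"
            and k = "\<lambda>_. k" and Q = "\<lambda>_. Q"])
        show "continuous_on {0..1} (\<lambda>t. x0 + t *\<^sub>R (x - x0))" by (intro continuous_intros)
        show "ball (x0 + t *\<^sub>R (x - x0)) (sqrt Q) \<subseteq> cball x0 (dist x0 x + R)" if "t \<in> {0..1}" for t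
        proof
          fix y assume "y \<in> ball (x0 + t *\<^sub>R (x - x0)) (sqrt Q)"
          moreover have "dist x0 (x0 + t *\<^sub>R (x - x0)) \<le> dist x0 x"
            using that by (simp add: dist_norm norm_minus_commute mult_left_le_one_le)
          ultimately show "y \<in> cball x0 (dist x0 x + R)"
            using dist_triangle[of x0 y "x0 + t *\<^sub>R (x - x0)"] by (simp add: R_def)
        qed
        show "6 * real CARD('n) * k / Q < f (a + s)"
          if "k * (4 / (real CARD('n) + 4)) ^ 3 \<le> s" "s \<le> k" for s
          using c(2)[of "a + s"] that Q(2) by (simp add: \<theta>_def n_def)
        show "a + k * (1 - (norm (y - (x0 + 0 *\<^sub>R (x - x0))))\<^sup>2 / Q) ^ 3 < u y" for y
        proof (cases "dist x0 y \<le> R")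
          case True
          have "k * (1 - (norm (y - x0))\<^sup>2 / Q) ^ 3 \<le> k * 1"
            using bump_le_one[of "(norm (y - x0))\<^sup>2" Q] Q k by (intro mult_left_mono) auto
          then have "a + k * (1 - (norm (y - x0))\<^sup>2 / Q) ^ 3 < u y" using big[OF True] by linarith
          then show ?thesis by simp
        next
          case False
          then have "R\<^sup>2 \<le> (norm (y - x0))\<^sup>2"
            using R by (intro power_mono) (auto simp: dist_norm norm_minus_commute)
          then have "1 - (norm (y - x0))\<^sup>2 / Q \<le> 0" using R Q by (simp add: field_simps)
          then have "(1 - (norm (y - x0))\<^sup>2 / Q) ^ 3 \<le> 0"
            using power_mono_odd[of 3 "1 - (norm (y - x0))\<^sup>2 / Q" 0] by simp
          then have "k * (1 - (norm (y - x0))\<^sup>2 / Q) ^ 3 \<le> 0" using k by (simp add: mult_le_0_iff)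
          then have "a + k * (1 - (norm (y - x0))\<^sup>2 / Q) ^ 3 < u y" using gt[of y] by linarith
          then show ?thesis by simp
        qed
      qed (use k Q gt in auto)
      then show ?thesis by simp
    qed
    show ?thesis using solution_bounded_away[OF u _ above] k by simp
  qed
  moreover have "a < C" "C < b" using k c' by (auto simp: C_def)
  ultimately show ?thesis using that by blast
qed

text \<open>If the limit inferior were above \<open>a\<close>, then \<open>u\<close> would be
  bounded away from \<open>a\<close> near infinity, and by compactness everywhere, which forces the
  constant \<open>b\<close>.\<close>

lemma liminf_entire_solution:
  fixes u :: "real^'n \<Rightarrow> real"
  assumes u: "solution UNIV u" and gt: "\<And>y. a < u y" and "u x0 \<noteq> b"
  shows "Liminf at_infinity (\<lambda>x. ereal (u x)) = ereal a"
proof (rule antisym)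
  show "ereal a \<le> Liminf at_infinity (\<lambda>x. ereal (u x))"
    using gt by (intro Liminf_bounded always_eventually) (auto simp: less_imp_le)
  show "Liminf at_infinity (\<lambda>x. ereal (u x)) \<le> ereal a"
  proof (rule ccontr)
    assume "\<not> Liminf at_infinity (\<lambda>x. ereal (u x)) \<le> ereal a"
    then obtain r where r: "ereal a < ereal r" "ereal r < Liminf at_infinity (\<lambda>x. ereal (u x))"
      using ereal_dense2[of "ereal a"] by (auto simp: not_le)
    obtain B where B: "\<And>x. B \<le> norm x \<Longrightarrow> r < u x"
      using less_LiminfD[OF r(2)] by (auto simp: eventually_at_infinity)
    obtain m where m: "0 < m" "\<And>y. dist 0 y \<le> B \<Longrightarrow> a + m \<le> u y"
      using solution_min_cball[OF u gt, of 0 B] by blast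
    have "min r (a + m) \<le> u y" for y
      using B[of y] m(2)[of y] by (cases "B \<le> norm y") auto
    then have "u x0 = b" using r m(1) by (intro solution_bounded_away[OF u, of "min r (a + m)"]) auto
    then show False using assms(3) by simp
  qed
qed

end

section \<open>Exterior barriers\<close>

lemma tendsto_powr_mult_ln_0:
  fixes \<beta> :: real
  assumes "0 < \<beta>"
  shows "((\<lambda>x. x powr - \<beta> * ln x) \<longlongrightarrow> 0) at_top"
proof (rule tendsto_sandwich)
  show "\<forall>\<^sub>F x in at_top. 0 \<le> x powr - \<beta> * ln x"
    using eventually_ge_at_top[of 1] by eventually_elim simp
  show "\<forall>\<^sub>F x in at_top. x powr - \<beta> * ln x \<le> 2 / \<beta> * x powr - (\<beta> / 2)"
    using eventually_ge_at_top[of 1]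
  proof eventually_elim
    case (elim x)
    have "x powr - \<beta> * ln x \<le> x powr - \<beta> * (x powr (\<beta> / 2) / (\<beta> / 2))"
      using elim assms by (intro mult_left_mono ln_powr_bound) auto
    also have "\<dots> = 2 / \<beta> * (x powr - \<beta> * x powr (\<beta> / 2))" by simp
    also have "x powr - \<beta> * x powr (\<beta> / 2) = x powr - (\<beta> / 2)"
      using powr_add[of x "- \<beta>" "\<beta> / 2"] by simp
    finally show ?case .
  qed
  have "((\<lambda>x. 2 / \<beta> * x powr - (\<beta> / 2)) \<longlongrightarrow> 2 / \<beta> * 0) at_top"
    using assms by (intro tendsto_intros tendsto_neg_powr filterlim_ident) auto
  then show "((\<lambda>x. 2 / \<beta> * x powr - (\<beta> / 2)) \<longlongrightarrow> 0) at_top" by simp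
qed simp

context potential
begin

text \<open>The unit ball is removed because logarithms and negative powers are singular at
  \<open>p\<close>. As \<open>u\<close> exceeds \<open>a\<close> everywhere, the outer condition
  concerns the barrier alone, so \<open>Q\<close> can afterwards be sent to infinity.\<close>

lemma exterior_comparison:
  fixes u :: "real^'n \<Rightarrow> real" and p :: "real^'n"
  assumes u: "solution UNIV u" and gt: "\<And>y. a < u y"
    and h: "\<And>s. 0 < s \<Longrightarrow> (h has_real_derivative h' s) (at s)"
    and h': "\<And>s. 0 < s \<Longrightarrow> (h' has_real_derivative h'' s) (at s)"
    and inner: "\<And>y. dist p y \<le> 1 \<Longrightarrow> h 1 \<le> u y" and outer: "h Q \<le> a"
    and sub: "\<And>y q. 1 < q \<Longrightarrow> q < Q \<Longrightarrow> q = (norm (y - p))\<^sup>2 \<Longrightarrow> u y < h q \<Longrightarrow>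
      - f (u y) < 2 * real CARD('n) * h' q + 4 * q * h'' q"
    and x: "1 \<le> (norm (x - p))\<^sup>2" "(norm (x - p))\<^sup>2 \<le> Q"
  shows "h ((norm (x - p))\<^sup>2) \<le> u x"
proof -
  define R where "R = sqrt Q"
  have R: "1 \<le> R" "R\<^sup>2 = Q" using x by (auto simp: R_def)
  have K_iff: "y \<in> cball p R - ball p 1 \<longleftrightarrow> 1 \<le> (norm (y - p))\<^sup>2 \<and> (norm (y - p))\<^sup>2 \<le> Q" for y
  proof -
    have "y \<in> cball p R - ball p 1 \<longleftrightarrow> \<not> norm (y - p) < 1 \<and> \<not> R < norm (y - p)"
      by (auto simp: dist_norm norm_minus_commute)
    also have "\<dots> \<longleftrightarrow> \<not> (norm (y - p))\<^sup>2 < 1\<^sup>2 \<and> norm (y - p) \<le> R"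
      by (subst square_norm_less_iff) auto
    also have "norm (y - p) \<le> R \<longleftrightarrow> (norm (y - p))\<^sup>2 \<le> R\<^sup>2"
      using R by (auto intro: power_mono dest: power2_le_imp_le)
    finally show ?thesis using R by auto
  qed
  have U_iff: "y \<in> ball p R - cball p 1 \<longleftrightarrow> 1 < (norm (y - p))\<^sup>2 \<and> (norm (y - p))\<^sup>2 < Q" for y
  proof -
    have "y \<in> ball p R - cball p 1 \<longleftrightarrow> norm (y - p) < R \<and> \<not> norm (y - p) \<le> 1"
      by (auto simp: dist_norm norm_minus_commute)
    also have "norm (y - p) \<le> 1 \<longleftrightarrow> (norm (y - p))\<^sup>2 \<le> 1\<^sup>2"
      using power2_le_imp_le[of "norm (y - p)" 1] by (auto intro: power_le_one)
    also have "norm (y - p) < R \<longleftrightarrow> (norm (y - p))\<^sup>2 < R\<^sup>2"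
      using R by (subst square_norm_less_iff) auto
    finally show ?thesis using R by auto
  qed
  show ?thesis
  proof (rule radial_comparison[where K = "cball p R - ball p 1" and U = "ball p R - cball p 1"
        and h' = h' and h'' = h''])
    show "compact (cball p R - ball p 1)" by (intro compact_diff) auto
    show "open (ball p R - cball p 1)" by auto
    show "ball p R - cball p 1 \<subseteq> cball p R - ball p 1" by auto
    show "continuous_on (cball p R - ball p 1) u"
      using solution_continuous[OF u] continuous_on_subset by blast
    show "continuous_on ((\<lambda>y. (norm (y - p))\<^sup>2) ` (cball p R - ball p 1)) h"
    proof (rule continuous_at_imp_continuous_on, rule ballI)
      fix s assume "s \<in> (\<lambda>y. (norm (y - p))\<^sup>2) ` (cball p R - ball p 1)"
      then obtain y where "y \<in> cball p R - ball p 1" "s = (norm (y - p))\<^sup>2" by blast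
      then have "0 < s" using K_iff[of y] by linarith
      then show "isCont h s" by (rule DERIV_isCont[OF h])
    qed
    show "has_lap u y (- f (u y))" for y using solution_has_lap[OF u] by simp
    show "x \<in> cball p R - ball p 1" using x K_iff by blast
    fix y
    show "h ((norm (y - p))\<^sup>2) \<le> u y"
      if y: "y \<in> cball p R - ball p 1 - (ball p R - cball p 1)"
    proof -
      have "1 \<le> (norm (y - p))\<^sup>2" "(norm (y - p))\<^sup>2 \<le> Q" using y K_iff[of y] by blast+
      moreover have "\<not> (1 < (norm (y - p))\<^sup>2 \<and> (norm (y - p))\<^sup>2 < Q)" using y U_iff[of y] by blast
      ultimately have "(norm (y - p))\<^sup>2 = 1 \<or> (norm (y - p))\<^sup>2 = Q" by linarith
      then show ?thesis
      proof
        assume 1: "(norm (y - p))\<^sup>2 = 1"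
        then have "dist p y \<le> 1" using power2_le_imp_le[of "norm (y - p)" 1]
          by (simp add: dist_norm norm_minus_commute)
        then show ?thesis using inner 1 by simp
      next
        assume "(norm (y - p))\<^sup>2 = Q"
        then show ?thesis using outer gt[of y] by simp
      qed
    qed
    assume "y \<in> ball p R - cball p 1"
    then have y: "1 < (norm (y - p))\<^sup>2" "(norm (y - p))\<^sup>2 < Q" using U_iff[of y] by blast+
    have "\<forall>\<^sub>F s in nhds ((norm (y - p))\<^sup>2). s \<in> {0<..}"
      using y by (intro eventually_nhds_in_open) auto
    then show "\<forall>\<^sub>F s in nhds ((norm (y - p))\<^sup>2). (h has_real_derivative h' s) (at s)"
      by eventually_elim (use h in auto)
    show "(h' has_real_derivative h'' ((norm (y - p))\<^sup>2)) (at ((norm (y - p))\<^sup>2))"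
      using y by (intro h') auto
    show "- f (u y) < 2 * real CARD('n) * h' q + 4 * q * h'' q" if "q = (norm (y - p))\<^sup>2" "u y < h q" for q
      using sub[of q y] that y by simp
  qed
qed

text \<open>In the plane the logarithm is harmonic. The barrier falling logarithmically from
  \<open>a + m\<close> at squared radius 1 to \<open>a\<close> at \<open>Q\<close> tends to
  \<open>a + m\<close> at each fixed point as \<open>Q\<close> grows, so \<open>u\<close> is bounded
  away from \<open>a\<close>.\<close>

lemma entire_solution_plane:
  fixes u :: "real^'n \<Rightarrow> real"
  assumes n: "CARD('n) = 2" and u: "solution UNIV u" and gt: "\<And>y. a < u y" and lt: "\<And>y. u y < b"
  shows "u x = b"
proof -
  obtain m where m: "0 < m" "\<And>y. dist 0 y \<le> 1 \<Longrightarrow> a + m \<le> u y"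
    using solution_min_cball[OF u gt, of 0 1] by blast
  have "a + m \<le> u y" for y
  proof (cases "dist 0 y \<le> 1")
    case True
    then show ?thesis by (rule m(2))
  next
    case False
    define q where "q = (norm y)\<^sup>2"
    have q: "1 < q" using False by (simp add: q_def one_less_power)
    have "a + m - m * ln q / ln Q \<le> u y" if Q: "q \<le> Q" for Q
    proof -
      define h where "h = (\<lambda>s. a + m - m / ln Q * ln s)"
      have "0 < ln Q" using Q q by simp
      have "h ((norm (y - 0))\<^sup>2) \<le> u y"
      proof (rule exterior_comparison[OF u gt, where Q = Q
            and h' = "\<lambda>s. - (m / ln Q) / s" and h'' = "\<lambda>s. m / ln Q / s\<^sup>2"])
        fix s :: real assume "0 < s"
        then show "(h has_real_derivative - (m / ln Q) / s) (at s)"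
          unfolding h_def using \<open>0 < ln Q\<close> by (auto intro!: derivative_eq_intros)
        show "((\<lambda>s. - (m / ln Q) / s) has_real_derivative m / ln Q / s\<^sup>2) (at s)"
          using \<open>0 < s\<close> \<open>0 < ln Q\<close> by (auto intro!: derivative_eq_intros simp: power2_eq_square)
      next
        show "h 1 \<le> u z" if "dist 0 z \<le> 1" for z using m(2)[OF that] by (simp add: h_def)
        show "h Q \<le> a" using \<open>0 < ln Q\<close> by (simp add: h_def)
        show "- f (u z) < 2 * real CARD('n) * (- (m / ln Q) / s) + 4 * s * (m / ln Q / s\<^sup>2)"
          if "1 < s" for z s
          using f_pos[OF gt[of z] lt[of z]] that by (simp add: n power2_eq_square)
        show "1 \<le> (norm (y - 0))\<^sup>2" "(norm (y - 0))\<^sup>2 \<le> Q" using q Q by (auto simp: q_def)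
      qed
      then show ?thesis by (simp add: h_def q_def)
    qed
    moreover have "((\<lambda>Q. a + m - m * ln q / ln Q) \<longlongrightarrow> a + m - 0) at_top"
      by (intro tendsto_intros tendsto_divide_0[OF tendsto_const]
          filterlim_at_top_imp_at_infinity[OF ln_at_top])
    ultimately show ?thesis
      using tendsto_upperbound[of "\<lambda>Q. a + m - m * ln q / ln Q" "a + m" at_top "u y"]
        eventually_mono[OF eventually_ge_at_top[of q]] by auto
  qed
  then show ?thesis using solution_bounded_away[OF u, of "a + m"] m(1) by simp
qed

text \<open>The exponent \<open>n/(n-2)\<close> is critical: the fundamental solution \<open>|x|\<^sup>2\<^sup>-\<^sup>n\<close> is a lower barrier, and inserting
  it into the nonlinearity improves it by a factor \<open>log |x|\<close>. This suffices to place
  a large bump with \<open>k = const \<sqdot> Q\<^sup>-\<^sup>\<beta>\<close>, \<open>\<beta> = (n-2)/2\<close>, below \<open>u\<close>; this family of subsolutions is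
  invariant under the scaling of the critical equation, and \<open>Q\<close> is then decreased until \<open>a + k = s0\<close>.\<close>

lemma entire_solution_critical_lower_bound:
  fixes u :: "real^'n \<Rightarrow> real" and p :: "real^'n"
  assumes n: "3 \<le> CARD('n)" and u: "solution UNIV u" and gt: "\<And>y. a < u y" and lt: "\<And>y. u y < b"
    and C0: "0 < C0" and s0: "a < s0" "s0 < b"
    and power: "\<And>s. a \<le> s \<Longrightarrow> s \<le> s0 \<Longrightarrow>
      C0 * (s - a) powr (real CARD('n) / (real CARD('n) - 2)) \<le> f s"
  shows "s0 < u p"
proof -
  define \<beta> where "\<beta> = (real CARD('n) - 2) / 2"
  define e where "e = real CARD('n) / (real CARD('n) - 2)"
  have \<beta>: "0 < \<beta>" and N: "real CARD('n) = 2 * \<beta> + 2" using n by (auto simp: \<beta>_def diff_divide_distrib)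
  have \<beta>e: "\<beta> * e = \<beta> + 1" and e: "e = 1 + 1 / \<beta>" using n by (auto simp: \<beta>_def e_def field_simps)
  have f_ge: "C0 * s powr e \<le> f (a + s)" if "0 \<le> s" "s \<le> s0 - a" for s
    using power[of "a + s"] that by (simp add: e_def)
  have powr_dec: "q powr (- \<beta> - 1) * q = q powr - \<beta>" "q powr (- \<beta> - 2) * q = q powr (- \<beta> - 1)" if "0 < q" for q
  proof -
    have exponents: "- \<beta> - 1 + 1 = - \<beta>" "- \<beta> - 2 + 1 = - \<beta> - 1" by simp_all
    have "q powr (- \<beta> - 1) * q powr 1 = q powr - \<beta>" "q powr (- \<beta> - 2) * q powr 1 = q powr (- \<beta> - 1)"
      by (simp_all only: powr_add[symmetric] exponents)
    then show "q powr (- \<beta> - 1) * q = q powr - \<beta>" "q powr (- \<beta> - 2) * q = q powr (- \<beta> - 1)"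
      using that by simp_all
  qed
  obtain m where m: "0 < m" "\<And>y. dist p y \<le> 1 \<Longrightarrow> a + m \<le> u y"
    using solution_min_cball[OF u gt, of p 1] by blast

  \<comment> \<open>For \<beta> = (n-2)/2 the coefficient 4\<beta> + 4 - 2n vanishes and the barrier
    is harmonic; strictness comes from f(u) > 0. Subtracting \<open>Q powr - \<beta>\<close> brings
    it to \<open>a\<close> on the outer sphere.\<close>
  have decay: "a + m * q powr - \<beta> \<le> u x" if q_def: "q = (norm (x - p))\<^sup>2" and q: "1 \<le> q" for x q
  proof -
    have "a + m * (q powr - \<beta> - Q powr - \<beta>) \<le> u x" if Q: "q \<le> Q" for Q
    proof -
      define h where "h = (\<lambda>s. a + m * (s powr - \<beta> - Q powr - \<beta>))"
      have "h ((norm (x - p))\<^sup>2) \<le> u x"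
      proof (rule exterior_comparison[OF u gt, where Q = Q and h' = "\<lambda>s. m * (- \<beta> * s powr (- \<beta> - 1))"
            and h'' = "\<lambda>s. m * (\<beta> * (\<beta> + 1) * s powr (- \<beta> - 2))"])
        fix s :: real assume s: "0 < s"
        then show "(h has_real_derivative m * (- \<beta> * s powr (- \<beta> - 1))) (at s)"
          unfolding h_def by (auto intro!: derivative_eq_intros)
        show "((\<lambda>s. m * (- \<beta> * s powr (- \<beta> - 1))) has_real_derivative m * (\<beta> * (\<beta> + 1) * s powr (- \<beta> - 2))) (at s)"
          by (rule powr_radial_derivs(2)[OF s])
      next
        have "0 \<le> m * Q powr - \<beta>" using m by simp
        then show "h 1 \<le> u z" if "dist p z \<le> 1" for z using m(2)[OF that] by (simp add: h_def algebra_simps)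
        show "h Q \<le> a" by (simp add: h_def)
        fix z s assume "(1::real) < s"
        then have s: "0 < s" by simp
        show "- f (u z) < 2 * real CARD('n) * (m * (- \<beta> * s powr (- \<beta> - 1))) +
            4 * s * (m * (\<beta> * (\<beta> + 1) * s powr (- \<beta> - 2)))"
          unfolding powr_radial_laplacian[OF s] using f_pos[OF gt[of z] lt[of z]] by (simp add: N)
      qed (use q Q q_def in auto)
      then show ?thesis by (simp add: h_def q_def)
    qed
    moreover have "((\<lambda>Q. a + m * (q powr - \<beta> - Q powr - \<beta>)) \<longlongrightarrow> a + m * (q powr - \<beta> - 0)) at_top"
      using \<beta> by (intro tendsto_intros tendsto_neg_powr filterlim_ident) auto
    ultimately show ?thesis
      using tendsto_upperbound[of "\<lambda>Q. a + m * (q powr - \<beta> - Q powr - \<beta>)" _ at_top "u x"]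
        eventually_mono[OF eventually_ge_at_top[of q]] by auto
  qed

  \<comment> \<open>The Laplacian of \<kappa> q^(-\<beta>) ln q is -4\<beta>\<kappa> q^(-\<beta>-1),
    and \<open>decay\<close> bounds f(u) below by C0 m^e q^(-\<beta>-1); the second entry makes the
    comparison strict. The first keeps the barrier at most \<open>s0\<close>, so that the power
    bound applies wherever \<open>u\<close> is below it.\<close>
  define \<kappa> where "\<kappa> = min (\<beta> * (s0 - a)) (C0 * m powr e / (8 * \<beta>))"
  have \<kappa>: "0 < \<kappa>" "\<kappa> \<le> \<beta> * (s0 - a)" "4 * \<beta> * \<kappa> < C0 * m powr e"
  proof -
    have A: "0 < C0 * m powr e" using C0 m by simp
    then show "0 < \<kappa>" "\<kappa> \<le> \<beta> * (s0 - a)" using \<beta> s0 by (auto simp: \<kappa>_def)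
    have "4 * \<beta> * \<kappa> \<le> 4 * \<beta> * (C0 * m powr e / (8 * \<beta>))"
      using \<beta> by (intro mult_left_mono) (auto simp: \<kappa>_def)
    also have "\<dots> < C0 * m powr e" using A \<beta> by simp
    finally show "4 * \<beta> * \<kappa> < C0 * m powr e" .
  qed

  have log_decay: "a + \<kappa> * (q powr - \<beta> * ln q) \<le> u x" if q_def: "q = (norm (x - p))\<^sup>2" and q: "1 \<le> q" for x q
  proof -
    have "a + \<kappa> * (q powr - \<beta> * ln q - Q powr - \<beta> * ln Q) \<le> u x" if Q: "q \<le> Q" for Q
    proof -
      define h where "h = (\<lambda>s. a + \<kappa> * (s powr - \<beta> * ln s - Q powr - \<beta> * ln Q))"
      define h' where "h' = (\<lambda>s. \<kappa> * (- \<beta> * s powr (- \<beta> - 1) * ln s + s powr (- \<beta> - 1)))"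
      define h'' where "h'' = (\<lambda>s. \<kappa> * (\<beta> * (\<beta> + 1) * s powr (- \<beta> - 2) * ln s - (2 * \<beta> + 1) * s powr (- \<beta> - 2)))"
      have "h ((norm (x - p))\<^sup>2) \<le> u x"
      proof (rule exterior_comparison[OF u gt, where Q = Q and h' = h' and h'' = h''])
        fix s :: real assume s: "0 < s"
        have "s powr - \<beta> * inverse s = s powr (- \<beta> - 1)" using s powr_dec(1)[OF s] by (simp add: field_simps)
        then show "(h has_real_derivative h' s) (at s)"
          unfolding h_def h'_def using s by (auto intro!: derivative_eq_intros simp: field_simps)
        have "s powr (- \<beta> - 1) = s powr (- \<beta> - 2) * s" using powr_dec(2)[OF s] by simp
        then show "(h' has_real_derivative h'' s) (at s)"
          unfolding h'_def h''_def using s by (auto intro!: derivative_eq_intros simp: algebra_simps)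
      next
        have "0 \<le> \<kappa> * (Q powr - \<beta> * ln Q)" using \<kappa> Q q by simp
        then show "h 1 \<le> u z" for z using gt[of z] by (simp add: h_def)
        show "h Q \<le> a" by (simp add: h_def)
        fix z s assume s: "1 < s" "s < Q" and s_def: "s = (norm (z - p))\<^sup>2" and less: "u z < h s"
        have "ln s \<le> s powr \<beta> / \<beta>" using s \<beta> by (intro ln_powr_bound) auto
        then have "s powr - \<beta> * ln s \<le> s powr - \<beta> * (s powr \<beta> / \<beta>)" by (intro mult_left_mono) auto
        also have "\<dots> = 1 / \<beta>" using s by (simp add: powr_minus)
        finally have "\<kappa> * (s powr - \<beta> * ln s) \<le> \<kappa> * (1 / \<beta>)" using \<kappa>(1) by (intro mult_left_mono) auto
        also have "\<dots> \<le> s0 - a" using \<kappa>(2) \<beta> by (simp add: field_simps)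
        finally have "u z - a \<le> s0 - a"
          using less \<open>0 \<le> \<kappa> * (Q powr - \<beta> * ln Q)\<close> by (simp add: h_def algebra_simps)
        then have "C0 * (u z - a) powr e \<le> f (u z)" using f_ge[of "u z - a"] gt[of z] by simp
        moreover have "(m * s powr - \<beta>) powr e \<le> (u z - a) powr e"
          using decay[OF s_def] s m e \<beta> by (intro powr_mono2) auto
        moreover have "(m * s powr - \<beta>) powr e = m powr e * s powr (- \<beta> - 1)"
          using m s \<beta>e by (simp add: powr_mult powr_powr)
        ultimately have "C0 * (m powr e * s powr (- \<beta> - 1)) \<le> f (u z)"
          using C0 by (metis mult_left_mono order_trans less_imp_le)
        moreover have "4 * \<beta> * \<kappa> * s powr (- \<beta> - 1) < C0 * m powr e * s powr (- \<beta> - 1)"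
          using \<kappa>(3) s by (intro mult_strict_right_mono) auto
        moreover have "2 * real CARD('n) * h' s + 4 * s * h'' s = - (4 * \<beta> * \<kappa> * s powr (- \<beta> - 1))"
        proof -
          have "s powr (- \<beta> - 1) = s powr (- \<beta> - 2) * s" using powr_dec(2)[of s] s by simp
          then show ?thesis unfolding h'_def h''_def N by (simp only:) (simp add: algebra_simps)
        qed
        ultimately show "- f (u z) < 2 * real CARD('n) * h' s + 4 * s * h'' s" by simp
      qed (use q Q q_def in auto)
      then show ?thesis by (simp add: h_def q_def)
    qed
    moreover have "((\<lambda>Q. a + \<kappa> * (q powr - \<beta> * ln q - Q powr - \<beta> * ln Q)) \<longlongrightarrow>
        a + \<kappa> * (q powr - \<beta> * ln q - 0)) at_top"
      using \<beta> by (intro tendsto_intros tendsto_powr_mult_ln_0)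
    ultimately show ?thesis
      using tendsto_upperbound[of "\<lambda>Q. a + \<kappa> * (q powr - \<beta> * ln q - Q powr - \<beta> * ln Q)" _ at_top "u x"]
        eventually_mono[OF eventually_ge_at_top[of q]] by auto
  qed

  define \<theta> where "\<theta> = (4 / (real CARD('n) + 4)) ^ 3"
  have \<theta>: "0 < \<theta>" by (simp add: \<theta>_def)
  \<comment> \<open>With k0^e = k0 A and \<beta>e = \<beta> + 1, both sides of the sweeping
    condition are multiples of k0 Q^(-\<beta>-1). It reduces to 6n < C0 \<theta>^e A for all
    \<open>Q\<close> at once.\<close>
  define A where "A = 6 * real CARD('n) / (C0 * \<theta> powr e) + 1"
  have A: "0 < A" "6 * real CARD('n) < C0 * \<theta> powr e * A"
    using C0 \<theta> by (auto simp: A_def field_simps intro!: add_pos_pos)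
  define k0 where "k0 = A powr \<beta>"
  have k0: "0 < k0" "k0 powr e = k0 * A"
    using A \<beta> by (auto simp: k0_def powr_powr \<beta>e powr_add)
  define Q1 where "Q1 = (k0 / (s0 - a)) powr (1 / \<beta>)"
  have Q1: "0 < Q1" "k0 * Q1 powr - \<beta> = s0 - a"
    using k0 s0 \<beta> by (auto simp: Q1_def powr_powr powr_minus)
  \<comment> \<open>From here outwards \<kappa> ln q is at least \<open>k0\<close>. This is the gain
    over \<open>decay\<close>, whose constant \<open>m\<close> is tied to \<open>u\<close> and may
    be smaller than \<open>k0\<close>. Inside, the positive minimum \<open>m1\<close> is available
    instead.\<close>
  define q1 where "q1 = exp (k0 / \<kappa>)"
  obtain m1 where m1: "0 < m1" "\<And>y. dist p y \<le> sqrt q1 \<Longrightarrow> a + m1 \<le> u y"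
    using solution_min_cball[OF u gt, of p "sqrt q1"] by blast
  \<comment> \<open>A start so wide that the bump is lower than \<open>m1\<close>; taking at least
    \<open>Q1\<close> makes the sweep from \<open>Q0\<close> to \<open>Q1\<close> a decrease of
    \<open>Q\<close>, hence an increase of the height up to \<open>s0 - a\<close>.\<close>
  define Q0 where "Q0 = max Q1 ((2 * k0 / m1) powr (1 / \<beta>))"
  have Q0: "Q1 \<le> Q0" "0 < Q0" "k0 * Q0 powr - \<beta> < m1"
  proof -
    show *: "Q1 \<le> Q0" "0 < Q0" using Q1 by (auto simp: Q0_def)
    have "2 * k0 / m1 = ((2 * k0 / m1) powr (1 / \<beta>)) powr \<beta>" using k0 m1 \<beta> by (simp add: powr_powr)
    also have "\<dots> \<le> Q0 powr \<beta>" using \<beta> by (intro powr_mono2) (auto simp: Q0_def)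
    finally show "k0 * Q0 powr - \<beta> < m1" using k0 m1 * by (simp add: powr_minus field_simps)
  qed
  define Q where "Q = (\<lambda>t. (1 - t) * Q0 + t * Q1)"
  have Q: "Q1 \<le> Q t" "Q t \<le> Q0" if "t \<in> {0..1}" for t
    using that Q0 convex_bound_le[of "- Q0" "- Q1" "- Q1" "1 - t" t] convex_bound_le[of Q0 Q0 Q1 "1 - t" t]
    by (auto simp: Q_def algebra_simps)
  have Qpos: "0 < Q t" if "t \<in> {0..1}" for t using Q[OF that] Q1 by linarith
  have "a + k0 * Q 1 powr - \<beta> < u ((\<lambda>_. p) (1::real))"
  proof (rule bump_sweep[OF u, where K = "cball p (sqrt Q0)" and Q = Q and k = "\<lambda>t. k0 * Q t powr - \<beta>"])
    show contQ: "continuous_on {0..1} Q" unfolding Q_def by (intro continuous_intros)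
    show "continuous_on {0..1} (\<lambda>t. k0 * Q t powr - \<beta>)"
      using Qpos by (intro continuous_intros contQ) force
    fix t :: real assume t: "t \<in> {0..1}"
    show k_pos: "0 < k0 * Q t powr - \<beta>" using k0 Qpos[OF t] by simp
    have "Q t powr - \<beta> \<le> Q1 powr - \<beta>" using Q[OF t] Q1 \<beta> by (intro powr_mono2') auto
    then have "k0 * Q t powr - \<beta> \<le> k0 * Q1 powr - \<beta>" using k0 by (intro mult_left_mono) auto
    then have k_le: "k0 * Q t powr - \<beta> \<le> s0 - a" using Q1 by simp
    then show "k0 * Q t powr - \<beta> < b - a" using s0 by simp
    show "ball p (sqrt (Q t)) \<subseteq> cball p (sqrt Q0)"
    proof
      fix y assume "y \<in> ball p (sqrt (Q t))"
      moreover have "sqrt (Q t) \<le> sqrt Q0" using Q[OF t] by simp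
      ultimately show "y \<in> cball p (sqrt Q0)" unfolding mem_ball mem_cball by linarith
    qed
    fix s assume s: "k0 * Q t powr - \<beta> * (4 / (real CARD('n) + 4)) ^ 3 \<le> s" "s \<le> k0 * Q t powr - \<beta>"
    then have s': "k0 * Q t powr - \<beta> * \<theta> \<le> s" by (simp add: \<theta>_def)
    have "(k0 * Q t powr - \<beta> * \<theta>) powr e = k0 * A * Q t powr (- \<beta> - 1) * \<theta> powr e"
      using k0 \<theta> Qpos[OF t] \<beta>e by (simp add: powr_mult powr_powr)
    moreover have "(k0 * Q t powr - \<beta> * \<theta>) powr e \<le> s powr e"
      using s' k_pos \<theta> e \<beta> by (intro powr_mono2) auto
    moreover have "0 \<le> s" using s' k_pos \<theta> by (smt (verit) mult_pos_pos)
    then have "C0 * s powr e \<le> f (a + s)" using s k_le by (intro f_ge) auto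
    ultimately have "C0 * (k0 * A * Q t powr (- \<beta> - 1) * \<theta> powr e) \<le> f (a + s)"
      using C0 by (smt (verit) mult_left_mono)
    moreover have "6 * real CARD('n) * (k0 * Q t powr (- \<beta> - 1)) < C0 * \<theta> powr e * A * (k0 * Q t powr (- \<beta> - 1))"
      using A(2) k0 Qpos[OF t] by (intro mult_strict_right_mono) auto
    moreover have "Q t powr - \<beta> / Q t = Q t powr (- \<beta> - 1)"
      using powr_dec(1)[OF Qpos[OF t]] Qpos[OF t] by (simp add: field_simps)
    then have "6 * real CARD('n) * (k0 * Q t powr - \<beta>) / Q t = 6 * real CARD('n) * (k0 * Q t powr (- \<beta> - 1))"
      by (metis times_divide_eq_right)
    ultimately show "6 * real CARD('n) * (k0 * Q t powr - \<beta>) / Q t < f (a + s)"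
      by (simp add: mult_ac)
  next
    fix y
    define q where "q = (norm (y - p))\<^sup>2"
    have "k0 * Q0 powr - \<beta> * (1 - q / Q0) ^ 3 < u y - a"
    proof (cases "q < Q0")
      case False
      then have "(1 - q / Q0) ^ 3 \<le> 0"
        using power_mono_odd[of 3 "1 - q / Q0" 0] Q0 by (simp add: field_simps)
      then have "k0 * Q0 powr - \<beta> * (1 - q / Q0) ^ 3 \<le> 0"
        using k0 by (intro mult_nonneg_nonpos) auto
      then show ?thesis using gt[of y] by simp
    next
      case True
      have "k0 * Q0 powr - \<beta> * (1 - q / Q0) ^ 3 \<le> k0 * Q0 powr - \<beta> * 1"
        using k0 Q0 bump_le_one[of q Q0] by (intro mult_left_mono) (auto simp: q_def)
      also have "k0 * Q0 powr - \<beta> * 1 < u y - a"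
      proof (cases "q1 \<le> q")
        case q: True
        have "1 \<le> q1" using k0 \<kappa> by (simp add: q1_def)
        then have q': "1 \<le> q" using q by simp
        have "Q0 powr - \<beta> < q powr - \<beta>" using True q' \<beta> by (intro powr_less_mono2_neg) auto
        then have "k0 * Q0 powr - \<beta> < k0 * q powr - \<beta>" using k0 by simp
        also have "\<dots> \<le> \<kappa> * ln q * q powr - \<beta>"
        proof -
          have "ln q1 \<le> ln q" using q \<open>1 \<le> q1\<close> by (intro ln_mono) auto
          then have "k0 \<le> \<kappa> * ln q" using \<kappa> by (simp add: q1_def field_simps)
          then show ?thesis by (intro mult_right_mono) auto
        qed
        also have "\<dots> \<le> u y - a" using log_decay[OF q_def q'] by (simp add: mult_ac)
        finally show ?thesis by simp
      next
        case False
        then have "dist p y \<le> sqrt q1"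
          by (intro real_le_rsqrt) (simp add: q_def dist_norm norm_minus_commute)
        then show ?thesis using m1(2) Q0(3) by fastforce
      qed
      finally show ?thesis .
    qed
    then show "a + k0 * Q 0 powr - \<beta> * (1 - (norm (y - p))\<^sup>2 / Q 0) ^ 3 < u y"
      by (simp add: Q_def q_def)
  qed (use gt Qpos in auto)
  then show ?thesis using Q1(2) by (simp add: Q_def)
qed

end

theorem theorem1p2:
  fixes a b :: real and W :: "real \<Rightarrow> real"
  assumes "2 \<le> CARD('n::finite)"
    and "a < b"
    and "C11_loc W"
    and "deriv W a = 0" and "deriv W b = 0"
    and "\<forall>s\<in>{a<..<b}. deriv W s < 0"
  shows
    "(CARD('n) = 2 \<or> CARD('n) \<ge> 3 \<and>
         power_bound_near W a b (real CARD('n) / (real CARD('n) - 2)) \<longrightarrow>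
        (\<forall>u :: real^'n \<Rightarrow> real.
           C2_on UNIV u \<longrightarrow> (\<forall>x. laplacian u x = deriv W (u x)) \<longrightarrow> range u \<subseteq> {a..b} \<longrightarrow>
           (\<forall>x. u x = a) \<or> (\<forall>x. u x = b))) \<and>
     (CARD('n) \<ge> 3 \<and>
        \<not> power_bound_near W a b (real CARD('n) / (real CARD('n) - 2)) \<longrightarrow>
        (\<exists>C\<in>{a<..<b}. \<forall>u :: real^'n \<Rightarrow> real.
           C2_on UNIV u \<longrightarrow> (\<forall>x. laplacian u x = deriv W (u x)) \<longrightarrow> range u \<subseteq> {a..b} \<longrightarrow>
           (\<forall>x. u x = a) \<or> (\<forall>x. u x = b) \<or>
           (range u \<subseteq> {a<..C} \<and> Liminf at_infinity (\<lambda>x. ereal (u x)) = ereal a))) \<and>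
     (\<forall>(D :: (real^'n) set) (u :: real^'n \<Rightarrow> real).
        connected D \<longrightarrow> open D \<longrightarrow> \<not> bounded D \<longrightarrow> (\<forall>R>0. \<exists>x. ball x R \<subseteq> D) \<longrightarrow>
        C2_on D u \<longrightarrow> (\<forall>x\<in>D. laplacian u x = deriv W (u x)) \<longrightarrow> u ` D \<subseteq> {a<..b} \<longrightarrow>
        (\<exists>C0>0. \<exists>s0\<in>{a<..<b}. \<forall>s\<in>{a..s0}. deriv W s \<le> - C0 * (s - a)) \<longrightarrow>
        tends_to_far_from_boundary D u b)"
proof -
  interpret potential W a b
    by unfold_locales (use assms(2-6) in auto)
  have solution: "solution D u"
    if "open D" "C2_on D u" "\<forall>x\<in>D. laplacian u x = deriv W (u x)" "u ` D \<subseteq> {a..b}"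
    for D and u :: "real^'n \<Rightarrow> real"
    using that by (simp add: solution_def f_def)
  have strict: "a < u y" if "solution UNIV u" "\<not> (\<forall>x. u x = a)" for u :: "real^'n \<Rightarrow> real" and y
    using that(2) solution_eq_a[OF that(1)] solution_range[OF that(1), of y] by (metis UNIV_I order_le_less)
  have strict': "u y < b" if "solution UNIV u" "\<not> (\<forall>x. u x = b)" for u :: "real^'n \<Rightarrow> real" and y
    using that(2) solution_eq_b[OF that(1)] solution_range[OF that(1), of y] by (metis UNIV_I order_le_less)
  show ?thesis
  proof (intro conjI impI)
    assume dim: "CARD('n) = 2 \<or> CARD('n) \<ge> 3 \<and>
      power_bound_near W a b (real CARD('n) / (real CARD('n) - 2))"
    show "\<forall>u :: real^'n \<Rightarrow> real.
       C2_on UNIV u \<longrightarrow> (\<forall>x. laplacian u x = deriv W (u x)) \<longrightarrow> range u \<subseteq> {a..b} \<longrightarrow>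
       (\<forall>x. u x = a) \<or> (\<forall>x. u x = b)"
    proof (intro allI impI, rule ccontr)
      fix u :: "real^'n \<Rightarrow> real"
      assume "C2_on UNIV u" "\<forall>x. laplacian u x = deriv W (u x)" "range u \<subseteq> {a..b}"
        and nc: "\<not> ((\<forall>x. u x = a) \<or> (\<forall>x. u x = b))"
      then have u: "solution UNIV u" by (intro solution) auto
      have gt: "\<And>y. a < u y" and lt: "\<And>y. u y < b" using strict[OF u] strict'[OF u] nc by auto
      from dim show False
      proof
        assume "CARD('n) = 2"
        then show False using entire_solution_plane[OF _ u gt lt] lt[of 0] by (metis less_irrefl)
      next
        assume *: "CARD('n) \<ge> 3 \<and> power_bound_near W a b (real CARD('n) / (real CARD('n) - 2))"
        obtain C0 s0 where C0: "0 < C0" "a < s0" "s0 < b"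
          "\<And>s. a \<le> s \<Longrightarrow> s \<le> s0 \<Longrightarrow> C0 * (s - a) powr (real CARD('n) / (real CARD('n) - 2)) \<le> f s"
        proof -
          obtain C0 s0 where "0 < C0" "s0 \<in> {a<..<b}"
            "\<forall>s\<in>{a..s0}. deriv W s \<le> - C0 * (s - a) powr (real CARD('n) / (real CARD('n) - 2))"
            using * unfolding power_bound_near_def by blast
          then show thesis by (intro that[of C0 s0]) (auto simp: f_def dest!: bspec)
        qed
        have "s0 < u p" for p
          by (rule entire_solution_critical_lower_bound[OF _ u gt lt C0]) (use * in auto)
        \<comment> \<open>The barriers depended on \<open>p\<close> through minima of
          \<open>u\<close>, but the bound \<open>s0\<close> reached at the end does not, so
          \<open>u\<close> is bounded away from \<open>a\<close> on the whole space.\<close>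
        then have "u 0 = b" by (intro solution_bounded_away[OF u \<open>a < s0\<close>] less_imp_le)
        then show False using lt[of 0] by simp
      qed
    qed
  next
    \<comment> \<open>The constant is fixed before any \<open>u\<close> is introduced, which
      expresses its independence of the solution.\<close>
    obtain C where C: "a < C" "C < b"
      "\<And>(u :: real^'n \<Rightarrow> real) x y. solution UNIV u \<Longrightarrow> (\<And>z. a < u z) \<Longrightarrow> C < u x \<Longrightarrow> u y = b"
      by (rule entire_solution_above[where 'n = 'n]) blast
    show "\<exists>C\<in>{a<..<b}. \<forall>u :: real^'n \<Rightarrow> real.
       C2_on UNIV u \<longrightarrow> (\<forall>x. laplacian u x = deriv W (u x)) \<longrightarrow> range u \<subseteq> {a..b} \<longrightarrow>
       (\<forall>x. u x = a) \<or> (\<forall>x. u x = b) \<or>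
       (range u \<subseteq> {a<..C} \<and> Liminf at_infinity (\<lambda>x. ereal (u x)) = ereal a)"
    proof (intro bexI[of _ C] allI impI)
      fix u :: "real^'n \<Rightarrow> real"
      assume "C2_on UNIV u" "\<forall>x. laplacian u x = deriv W (u x)" "range u \<subseteq> {a..b}"
      then have u: "solution UNIV u" by (intro solution) auto
      show "(\<forall>x. u x = a) \<or> (\<forall>x. u x = b) \<or>
         (range u \<subseteq> {a<..C} \<and> Liminf at_infinity (\<lambda>x. ereal (u x)) = ereal a)"
      proof (cases "(\<forall>x. u x = a) \<or> (\<forall>x. u x = b)")
        case False
        then have gt: "\<And>y. a < u y" using strict[OF u] by auto
        obtain x0 where x0: "u x0 \<noteq> b" using False by blast
        have "u x \<le> C" for x using C(3)[OF u gt, of x x0] x0 by (meson not_le)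
        then show ?thesis using gt liminf_entire_solution[OF u gt x0] by auto
      qed auto
    qed (use C in auto)
  next
    show "\<forall>(D :: (real^'n) set) (u :: real^'n \<Rightarrow> real).
        connected D \<longrightarrow> open D \<longrightarrow> \<not> bounded D \<longrightarrow> (\<forall>R>0. \<exists>x. ball x R \<subseteq> D) \<longrightarrow>
        C2_on D u \<longrightarrow> (\<forall>x\<in>D. laplacian u x = deriv W (u x)) \<longrightarrow> u ` D \<subseteq> {a<..b} \<longrightarrow>
        (\<exists>C0>0. \<exists>s0\<in>{a<..<b}. \<forall>s\<in>{a..s0}. deriv W s \<le> - C0 * (s - a)) \<longrightarrow>
        tends_to_far_from_boundary D u b"
    proof (intro allI impI)
      fix D :: "(real^'n) set" and u :: "real^'n \<Rightarrow> real"
      assume D: "open D" "C2_on D u" "\<forall>x\<in>D. laplacian u x = deriv W (u x)" and ran: "u ` D \<subseteq> {a<..b}"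
        and lin: "\<exists>C0>0. \<exists>s0\<in>{a<..<b}. \<forall>s\<in>{a..s0}. deriv W s \<le> - C0 * (s - a)"
      obtain C0 s0 where C0: "0 < C0" "a < s0" "s0 < b"
        "\<And>s. a \<le> s \<Longrightarrow> s \<le> s0 \<Longrightarrow> C0 * (s - a) \<le> f s"
      proof -
        obtain C0 s0 where "0 < C0" "s0 \<in> {a<..<b}" "\<forall>s\<in>{a..s0}. deriv W s \<le> - C0 * (s - a)"
          using lin by blast
        then show thesis by (intro that[of C0 s0]) (auto simp: f_def dest!: bspec)
      qed
      have "u ` D \<subseteq> {a..b}" using ran by auto
      then have "solution D u" by (rule solution[OF D])
      then show "tends_to_far_from_boundary D u b"
        using ran by (intro tends_to_far_from_boundary_b[OF _ _ C0]) auto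
    qed
  qed
qed

end
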